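(* Let $\mathcal{F}_t$ ($t\in\mathbb{R}$) be a smoothly varying $1$-parameter family of transversely oriented codimension one foliations on a smooth manifold $M$. Let $\alpha=\alpha(t)$ be a smooth family of positive defining $1$-forms for $\mathcal{F}_t$ and $\beta=\beta(t)$ a smooth family of $1$-forms with $d\alpha=\alpha\wedge\beta$. Then for every $t\in\mathbb{R}$ the $4$-form $(\dot\beta\wedge\beta\wedge d\beta)(t)$ is closed, and its cohomology class in $H^4(M,\mathbb{R})$ is an invariant of the family $\mathcal{F}_t$. In particular, this class is independent of the choices made for $\alpha$ and $\beta$.
   Context: All manifolds, foliations, forms and families are of class $C^\infty$. For a $1$-parameter family all forms are functions of the parameter $t$ (depending smoothly on $t$), $d$ is the exterior derivative on $M$, and a dot denotes the derivative with respect to $t$. A positive defining form for a transversely oriented codimension one foliation $\mathcal{F}$ is a nowhere vanishing $1$-form $\alpha$ with $\ker\alpha=T\mathcal{F}$ which is positive on positively oriented transversals. By the Frobenius theorem there is a $1$-form $\beta$ with $d\alpha=\alpha\wedge\beta$. *)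

theory Defs
  imports "HOL-Analysis.Analysis"
begin

section \<open>Smooth maps\<close>

text \<open>Only meant for open sets: the derivatives are the unrestricted ones.\<close>

primrec Ck_on ::
  "nat \<Rightarrow> 'a::real_normed_vector set \<Rightarrow> ('a \<Rightarrow> 'b::real_normed_vector) \<Rightarrow> bool" where
  "Ck_on 0 S f \<longleftrightarrow> continuous_on S f"
| "Ck_on (Suc k) S f \<longleftrightarrow>
     (\<forall>x\<in>S. f differentiable (at x)) \<and>
     (\<forall>v. Ck_on k S (\<lambda>x. frechet_derivative f (at x) v))"

definition smooth_on ::
  "'a::real_normed_vector set \<Rightarrow> ('a \<Rightarrow> 'b::real_normed_vector) \<Rightarrow> bool" where
  "smooth_on S f \<longleftrightarrow> (\<forall>k. Ck_on k S f)"

section \<open>Smooth manifolds\<close>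

text \<open>
  A chart is a pair of a domain and a coordinate map into the model space \<open>'e\<close>, a Euclidean space
  of arbitrary dimension at least one. The values of the coordinate map outside the domain are
  irrelevant.
\<close>

type_synonym ('a, 'e) chart = "'a set \<times> ('a \<Rightarrow> 'e)"

definition codom :: "('a, 'e) chart \<Rightarrow> 'e set" where
  "codom c = snd c ` fst c"

definition chart_inv :: "('a, 'e) chart \<Rightarrow> 'e \<Rightarrow> 'a" where
  "chart_inv c = inv_into (fst c) (snd c)"

definition overlap :: "('a, 'e) chart \<Rightarrow> ('a, 'e) chart \<Rightarrow> 'e set" where
  "overlap c d = snd c ` (fst c \<inter> fst d)"

definition transition :: "('a, 'e) chart \<Rightarrow> ('a, 'e) chart \<Rightarrow> 'e \<Rightarrow> 'e" where
  "transition c d = (\<lambda>x. snd d (chart_inv c x))"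

definition is_chart :: "'a topology \<Rightarrow> ('a, 'e::euclidean_space) chart \<Rightarrow> bool" where
  "is_chart M c \<longleftrightarrow>
     openin M (fst c) \<and> open (codom c) \<and>
     homeomorphic_map (subtopology M (fst c)) (top_of_set (codom c)) (snd c)"

definition smoothly_compatible ::
  "('a, 'e::euclidean_space) chart \<Rightarrow> ('a, 'e) chart \<Rightarrow> bool" where
  "smoothly_compatible c d \<longleftrightarrow>
     smooth_on (overlap c d) (transition c d) \<and> smooth_on (overlap d c) (transition d c)"

definition smooth_structure ::
  "'a topology \<Rightarrow> ('a, 'e::euclidean_space) chart set \<Rightarrow> bool" where
  "smooth_structure M A \<longleftrightarrow>
     (\<forall>c\<in>A. is_chart M c) \<and>
     (\<Union>c\<in>A. fst c) = topspace M \<and>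
     (\<forall>c\<in>A. \<forall>d\<in>A. smoothly_compatible c d) \<and>
     (\<forall>c. is_chart M c \<and> (\<forall>d\<in>A. smoothly_compatible c d) \<longrightarrow> c \<in> A)"

definition smooth_manifold ::
  "'a topology \<Rightarrow> ('a, 'e::euclidean_space) chart set \<Rightarrow> bool" where
  "smooth_manifold M A \<longleftrightarrow>
     Hausdorff_space M \<and> second_countable M \<and> smooth_structure M A"

section \<open>Differential forms\<close>

text \<open>
  A form is given by its coordinate expressions: \<open>\<omega> c x v\<close> is the value, at the point with
  coordinates \<open>x\<close> in the chart \<open>c\<close>, of \<open>\<omega>\<close> on the tangent vectors with components
  \<open>v 0, \<dots>, v (k - 1)\<close> in that chart; the expressions transform by pullback. Values for \<open>c\<close>
  outside the atlas or \<open>x\<close> outside \<open>codom c\<close> carry no meaning, so forms are compared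
  with \<open>form_eq\<close>.
\<close>

type_synonym ('a, 'e) form = "('a, 'e) chart \<Rightarrow> 'e \<Rightarrow> (nat \<Rightarrow> 'e) \<Rightarrow> real"

definition alternating_multilinear ::
  "nat \<Rightarrow> ((nat \<Rightarrow> 'e::real_vector) \<Rightarrow> real) \<Rightarrow> bool" where
  "alternating_multilinear k f \<longleftrightarrow>
     (\<forall>v w. (\<forall>i<k. v i = w i) \<longrightarrow> f v = f w) \<and>
     (\<forall>i<k. \<forall>v. linear (\<lambda>u. f (v(i := u)))) \<and>
     (\<forall>v. \<forall>i<k. \<forall>j<k. i \<noteq> j \<and> v i = v j \<longrightarrow> f v = 0)"

definition k_form ::
  "('a, 'e::euclidean_space) chart set \<Rightarrow> nat \<Rightarrow> ('a, 'e) form \<Rightarrow> bool" where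
  "k_form A k \<omega> \<longleftrightarrow>
     (\<forall>c\<in>A. \<forall>x\<in>codom c. alternating_multilinear k (\<omega> c x)) \<and>
     (\<forall>c\<in>A. \<forall>v. smooth_on (codom c) (\<lambda>x. \<omega> c x v)) \<and>
     (\<forall>c\<in>A. \<forall>d\<in>A. \<forall>x\<in>overlap c d. \<forall>v.
        \<omega> c x v =
        \<omega> d (transition c d x) (\<lambda>i. frechet_derivative (transition c d) (at x) (v i)))"

definition form_eq ::
  "('a, 'e) chart set \<Rightarrow> ('a, 'e) form \<Rightarrow> ('a, 'e) form \<Rightarrow> bool" where
  "form_eq A \<omega> \<eta> \<longleftrightarrow> (\<forall>c\<in>A. \<forall>x\<in>codom c. \<forall>v. \<omega> c x v = \<eta> c x v)"

definition zero_form :: "('a, 'e) form" where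
  "zero_form = (\<lambda>c x v. 0)"

definition form_diff :: "('a, 'e) form \<Rightarrow> ('a, 'e) form \<Rightarrow> ('a, 'e) form" where
  "form_diff \<omega> \<eta> = (\<lambda>c x v. \<omega> c x v - \<eta> c x v)"

text \<open>
  The wedge product of a \<open>k\<close>-form and an \<open>l\<close>-form, normalised so that
  \<open>(\<alpha> \<and> \<beta>)(X, Y) = \<alpha>(X) \<beta>(Y) - \<alpha>(Y) \<beta>(X)\<close> for 1-forms.
\<close>

definition wedge ::
  "nat \<Rightarrow> nat \<Rightarrow> ('a, 'e) form \<Rightarrow> ('a, 'e) form \<Rightarrow> ('a, 'e) form" where
  "wedge k l \<omega> \<eta> = (\<lambda>c x v.
     (\<Sum>\<sigma> | \<sigma> permutes {..<k + l}.
        of_int (sign \<sigma>) * \<omega> c x (\<lambda>i. v (\<sigma> i)) * \<eta> c x (\<lambda>i. v (\<sigma> (k + i))))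
     / (fact k * fact l))"

text \<open>
  The exterior derivative of a \<open>k\<close>-form, evaluated on coordinate vectors extended to
  constant vector fields, so that the bracket terms of the invariant formula vanish.
\<close>

definition ext_deriv ::
  "nat \<Rightarrow> ('a, 'e::euclidean_space) form \<Rightarrow> ('a, 'e) form" where
  "ext_deriv k \<omega> = (\<lambda>c x v.
     (\<Sum>i\<le>k. (- 1) ^ i *
        frechet_derivative (\<lambda>y. \<omega> c y (\<lambda>j. if j < i then v j else v (Suc j))) (at x) (v i)))"

section \<open>De Rham cohomology\<close>

definition closed_form ::
  "('a, 'e::euclidean_space) chart set \<Rightarrow> nat \<Rightarrow> ('a, 'e) form \<Rightarrow> bool" where
  "closed_form A k \<omega> \<longleftrightarrow> k_form A k \<omega> \<and> form_eq A (ext_deriv k \<omega>) zero_form"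

definition exact_form ::
  "('a, 'e::euclidean_space) chart set \<Rightarrow> nat \<Rightarrow> ('a, 'e) form \<Rightarrow> bool" where
  "exact_form A k \<omega> \<longleftrightarrow>
     (if k = 0 then form_eq A \<omega> zero_form
      else \<exists>\<theta>. k_form A (k - 1) \<theta> \<and> form_eq A \<omega> (ext_deriv (k - 1) \<theta>))"

definition cohomologous ::
  "('a, 'e::euclidean_space) chart set \<Rightarrow> nat \<Rightarrow> (('a, 'e) form \<times> ('a, 'e) form) set" where
  "cohomologous A k =
     {(\<omega>, \<eta>). closed_form A k \<omega> \<and> closed_form A k \<eta> \<and> exact_form A k (form_diff \<omega> \<eta>)}"

definition de_Rham_cohomology ::
  "('a, 'e::euclidean_space) chart set \<Rightarrow> nat \<Rightarrow> ('a, 'e) form set set" where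
  "de_Rham_cohomology A k = {\<omega>. closed_form A k \<omega>} // cohomologous A k"

definition cohomology_class ::
  "('a, 'e::euclidean_space) chart set \<Rightarrow> nat \<Rightarrow> ('a, 'e) form \<Rightarrow> ('a, 'e) form set" where
  "cohomology_class A k \<omega> = cohomologous A k `` {\<omega>}"

section \<open>Families of forms\<close>

definition smooth_form_family ::
  "('a, 'e::euclidean_space) chart set \<Rightarrow> nat \<Rightarrow> (real \<Rightarrow> ('a, 'e) form) \<Rightarrow> bool" where
  "smooth_form_family A k \<omega> \<longleftrightarrow>
     (\<forall>t. k_form A k (\<omega> t)) \<and>
     (\<forall>c\<in>A. \<forall>v. smooth_on (UNIV \<times> codom c) (\<lambda>(t, x). \<omega> t c x v))"

definition form_dot :: "(real \<Rightarrow> ('a, 'e) form) \<Rightarrow> real \<Rightarrow> ('a, 'e) form" where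
  "form_dot \<omega> t = (\<lambda>c x v. deriv (\<lambda>s. \<omega> s c x v) t)"

section \<open>Transversely oriented foliations of codimension one\<close>

text \<open>
  The model space is split into the line spanned by one basis vector, which carries the transverse
  coordinate, and its orthogonal complement, which is tangent to the plaques.
\<close>

definition transverse_axis :: "'e::euclidean_space" where
  "transverse_axis = (SOME b. b \<in> Basis)"

definition transverse_coord :: "'e::euclidean_space \<Rightarrow> real" where
  "transverse_coord x = x \<bullet> transverse_axis"

text \<open>
  Locally, the transverse coordinate of \<open>d\<close> is an orientation preserving local
  diffeomorphism of the line applied to the transverse coordinate of \<open>c\<close>.
\<close>

definition foliated_compatible ::
  "('a, 'e::euclidean_space) chart \<Rightarrow> ('a, 'e) chart \<Rightarrow> bool" where
  "foliated_compatible c d \<longleftrightarrow>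
     (\<forall>x\<in>overlap c d. \<exists>N J g.
        open N \<and> x \<in> N \<and> N \<subseteq> overlap c d \<and>
        open J \<and> smooth_on J g \<and> (\<forall>y\<in>J. deriv g y > 0) \<and>
        (\<forall>z\<in>N. transverse_coord z \<in> J \<and>
                transverse_coord (transition c d z) = g (transverse_coord z)))"

text \<open>
  A transversely oriented foliation is identified with its maximal atlas of
  positively oriented foliated charts.
\<close>

definition foliation ::
  "('a, 'e::euclidean_space) chart set \<Rightarrow> ('a, 'e) chart set \<Rightarrow> bool" where
  "foliation A F \<longleftrightarrow>
     F \<subseteq> A \<and>
     (\<Union>c\<in>F. fst c) = (\<Union>c\<in>A. fst c) \<and>
     (\<forall>c\<in>F. \<forall>d\<in>F. foliated_compatible c d) \<and>
     (\<forall>c\<in>A. (\<forall>d\<in>F. foliated_compatible c d \<and> foliated_compatible d c) \<longrightarrow> c \<in> F)"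

text \<open>
  \<open>transverse_part F c x r v\<close>: for some foliated chart around the point with coordinates \<open>x\<close> in
  the chart \<open>c\<close>, the differential of its transverse coordinate sends the vector with
  components \<open>v\<close> in \<open>c\<close> to \<open>r\<close>. The sign of \<open>r\<close> does not depend on the foliated chart:
  it is zero for vectors tangent to the leaves and positive for the velocity vectors of positively
  oriented transversals.
\<close>

definition transverse_part ::
  "('a, 'e::euclidean_space) chart set \<Rightarrow> ('a, 'e) chart \<Rightarrow> 'e \<Rightarrow> real \<Rightarrow> 'e \<Rightarrow> bool" where
  "transverse_part F c x r v \<longleftrightarrow>
     (\<exists>d\<in>F. chart_inv c x \<in> fst d \<and>
        transverse_coord (frechet_derivative (transition c d) (at x) v) = r)"

definition leaf_tangent ::
  "('a, 'e::euclidean_space) chart set \<Rightarrow> ('a, 'e) chart \<Rightarrow> 'e \<Rightarrow> 'e set" where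
  "leaf_tangent F c x = {v. transverse_part F c x 0 v}"

definition positive_transverse ::
  "('a, 'e::euclidean_space) chart set \<Rightarrow> ('a, 'e) chart \<Rightarrow> 'e \<Rightarrow> 'e set" where
  "positive_transverse F c x = {v. \<exists>r>0. transverse_part F c x r v}"

text \<open>
  Smooth dependence on the parameter means that the transversely oriented tangent hyperplanes of
  the leaves have local positive normal covectors that are jointly smooth in parameter and point.
\<close>

definition smooth_foliation_family ::
  "('a, 'e::euclidean_space) chart set \<Rightarrow> (real \<Rightarrow> ('a, 'e) chart set) \<Rightarrow> bool" where
  "smooth_foliation_family A F \<longleftrightarrow>
     (\<forall>t. foliation A (F t)) \<and>
     (\<forall>c\<in>A. \<forall>t\<^sub>0. \<forall>x\<^sub>0\<in>codom c. \<exists>W (n :: real \<times> 'e \<Rightarrow> 'e).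
        open W \<and> (t\<^sub>0, x\<^sub>0) \<in> W \<and> W \<subseteq> UNIV \<times> codom c \<and> smooth_on W n \<and>
        (\<forall>(t, x)\<in>W. leaf_tangent (F t) c x = {v. n (t, x) \<bullet> v = 0} \<and>
                    positive_transverse (F t) c x = {v. n (t, x) \<bullet> v > 0}))"

definition nowhere_vanishing :: "('a, 'e) chart set \<Rightarrow> ('a, 'e) form \<Rightarrow> bool" where
  "nowhere_vanishing A \<omega> \<longleftrightarrow> (\<forall>c\<in>A. \<forall>x\<in>codom c. \<exists>v. \<omega> c x v \<noteq> 0)"

definition positive_defining_form ::
  "('a, 'e::euclidean_space) chart set \<Rightarrow> ('a, 'e) chart set \<Rightarrow> ('a, 'e) form \<Rightarrow> bool" where
  "positive_defining_form A F \<alpha> \<longleftrightarrow>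
     k_form A 1 \<alpha> \<and> nowhere_vanishing A \<alpha> \<and>
     (\<forall>c\<in>A. \<forall>x\<in>codom c. {v. \<alpha> c x (\<lambda>_. v) = 0} = leaf_tangent F c x) \<and>
     (\<forall>c\<in>A. \<forall>x\<in>codom c. \<forall>v\<in>positive_transverse F c x. \<alpha> c x (\<lambda>_. v) > 0)"

text \<open>Admissible choices of \<open>\<alpha>\<close> and \<open>\<beta>\<close> for a family of foliations.\<close>

definition defining_pair ::
  "('a, 'e::euclidean_space) chart set \<Rightarrow> (real \<Rightarrow> ('a, 'e) chart set) \<Rightarrow>
   (real \<Rightarrow> ('a, 'e) form) \<Rightarrow> (real \<Rightarrow> ('a, 'e) form) \<Rightarrow> bool" where
  "defining_pair A F \<alpha> \<beta> \<longleftrightarrow>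
     smooth_form_family A 1 \<alpha> \<and> (\<forall>t. positive_defining_form A (F t) (\<alpha> t)) \<and>
     smooth_form_family A 1 \<beta> \<and>
     (\<forall>t. form_eq A (ext_deriv 1 (\<alpha> t)) (wedge 1 1 (\<alpha> t) (\<beta> t)))"

text \<open>The 4-form \<open>\<beta>' \<and> \<beta> \<and> d\<beta>\<close> at parameter \<open>t\<close>, where \<open>\<beta>'\<close> is the \<open>t\<close>-derivative.\<close>

definition dot_beta_form :: "(real \<Rightarrow> ('a, 'e::euclidean_space) form) \<Rightarrow> real \<Rightarrow> ('a, 'e) form"
  where
  "dot_beta_form \<beta> t =
     wedge 2 2 (wedge 1 1 (form_dot \<beta> t) (\<beta> t)) (ext_deriv 1 (\<beta> t))"

end

theory Submission
  imports Defs
begin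

text \<open>
  Write \<open>\<beta>\<^sub>t\<close> for the derivative of \<open>\<beta>\<close> in the parameter. The proof consists of two quadratic
  identities, which hold for every \<open>t\<close> and are therefore differentiated in \<open>t\<close>, and of two explicit
  primitives.

  \<^bold>\<open>Closedness.\<close> Applying \<open>d\<close> to \<open>d\<alpha> = \<alpha> \<and> \<beta>\<close> gives \<open>\<alpha> \<and> d\<beta> = 0\<close>. As \<open>\<alpha>\<close> vanishes nowhere, it
  divides \<open>d\<beta>\<close> at every point: \<open>d\<beta> = \<alpha> \<and> \<gamma>\<close>. Since \<open>d\<alpha>\<close> is also divisible by \<open>\<alpha>\<close>, both \<open>d\<beta> \<and> d\<beta>\<close>
  and \<open>d\<alpha> \<and> d\<beta>\<close> vanish (\<open>frobenius_pair_wedge_eq_0\<close>). Differentiating in \<open>t\<close> and using that \<open>d\<close>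
  commutes with this derivative (\<open>ext_deriv_form_dot\<close>) yields \<open>d\<beta>\<^sub>t \<and> d\<beta> = 0\<close> and
  \<open>d\<beta>\<^sub>t \<and> d\<alpha> = - d\<alpha>\<^sub>t \<and> d\<beta>\<close>. Hence both terms of
  \<open>d (\<beta>\<^sub>t \<and> \<beta> \<and> d\<beta>) = d\<beta>\<^sub>t \<and> \<beta> \<and> d\<beta> - \<beta>\<^sub>t \<and> d\<beta> \<and> d\<beta>\<close> vanish.

  \<^bold>\<open>Independence.\<close> Two positive defining forms have the same kernel and the same sign on positive
  transverse vectors, so \<open>\<alpha>' = f \<alpha>\<close> with \<open>f > 0\<close>. Put \<open>h = - ln f\<close>. Then \<open>\<beta> + dh\<close> is admissible for
  \<open>\<alpha>'\<close>, and any other admissible form for \<open>\<alpha>'\<close> differs from it by a multiple \<open>g \<alpha>'\<close>. Hence two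
  changes have to be compared:

    \<^item> for \<open>\<beta>' = \<beta> + dh\<close> the two 4-forms differ by \<open>d (h\<^sub>t \<beta>' \<and> d\<beta> - h \<beta>\<^sub>t \<and> d\<beta>)\<close>
      (\<open>exact_form_diff_add_differential\<close>), because \<open>d\<beta> \<and> d\<beta> = d\<beta>\<^sub>t \<and> d\<beta> = 0\<close>;

    \<^item> for \<open>\<beta>' = \<beta> + g \<alpha>\<close> with the same \<open>\<alpha>\<close> they differ by \<open>- 1/2 d (g (\<beta>\<^sub>t + \<beta>'\<^sub>t) \<and> d\<alpha>)\<close>
      (\<open>exact_form_diff_same_defining_form\<close>), because \<open>(d\<beta>\<^sub>t + d\<beta>'\<^sub>t) \<and> d\<alpha> = - d\<alpha>\<^sub>t \<and> (d\<beta> + d\<beta>')\<close> and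
      \<open>d\<alpha>\<^sub>t = \<alpha>\<^sub>t \<and> \<beta> + \<alpha> \<and> \<beta>\<^sub>t\<close>.

  The functions \<open>f\<close> and \<open>g\<close> are determined by the forms, so they are globally defined and the
  primitives are global forms.

  In terms of coordinate expressions, the primitives and the 4-form must
  transform by pullback; as only \<open>dh\<close> and differentials of 1-forms occur in them, naturality of \<open>d\<close>
  is needed in degrees 0 and 1 only. Naturality in degree 1, the identity \<open>d d = 0\<close>, and the fact
  that \<open>d\<close> commutes with the parameter derivative all rest on the symmetry of second derivatives. All
  remaining identities are pointwise: wedge products are expanded into signed sums over shuffles of
  the argument vectors, and what is left is polynomial algebra in the values of the forms.
\<close>

section \<open>Calculus of smooth functions\<close>

abbreviation dir_deriv ::
  "('a::real_normed_vector \<Rightarrow> 'b::real_normed_vector) \<Rightarrow> 'a \<Rightarrow> 'a \<Rightarrow> 'b" where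
  "dir_deriv f x v \<equiv> frechet_derivative f (at x) v"

lemma has_derivative_cong_open:
  assumes "open S" "x \<in> S" "\<And>y. y \<in> S \<Longrightarrow> f y = g y"
  shows "(f has_derivative f') (at x) \<longleftrightarrow> (g has_derivative f') (at x)"
  using assms has_derivative_transform_within_open[of f f' x UNIV S g]
    has_derivative_transform_within_open[of g f' x UNIV S f] by auto

lemma frechet_derivative_cong_open:
  assumes "open S" "x \<in> S" "\<And>y. y \<in> S \<Longrightarrow> f y = g y"
  shows "frechet_derivative f (at x) = frechet_derivative g (at x)"
  using has_derivative_cong_open[OF assms] by (simp add: frechet_derivative_def)

lemma dir_derivI: "(f has_derivative f') (at x) \<Longrightarrow> dir_deriv f x v = f' v"
  using frechet_derivative_at by metis

lemma Ck_on_cong: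
  assumes "open S" "\<And>x. x \<in> S \<Longrightarrow> f x = g x"
  shows "Ck_on k S f \<longleftrightarrow> Ck_on k S g"
  using assms(2)
proof (induction k arbitrary: f g)
  case 0
  then show ?case by (auto intro: continuous_on_eq)
next
  case (Suc k)
  have d: "frechet_derivative f (at x) = frechet_derivative g (at x)" if "x \<in> S" for x
    using frechet_derivative_cong_open[OF assms(1) that] Suc.prems by blast
  have "f differentiable (at x) \<longleftrightarrow> g differentiable (at x)" if "x \<in> S" for x
    unfolding differentiable_def
    using has_derivative_cong_open[OF assms(1) that, of f g] Suc.prems by simp
  moreover have "Ck_on k S (\<lambda>x. dir_deriv f x v) \<longleftrightarrow> Ck_on k S (\<lambda>x. dir_deriv g x v)" for v
    by (rule Suc.IH) (simp only: d)
  ultimately show ?case by simp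
qed

lemma Ck_on_Suc_imp: "Ck_on (Suc k) S f \<Longrightarrow> Ck_on k S f"
proof (induction k arbitrary: f)
  case 0
  then show ?case
    by (auto intro!: continuous_at_imp_continuous_on differentiable_imp_continuous_within)
next
  case (Suc k)
  have "\<forall>x\<in>S. f differentiable (at x)" "\<forall>v. Ck_on (Suc k) S (\<lambda>x. dir_deriv f x v)"
    using Suc.prems by (auto simp only: Ck_on.simps(2)[of "Suc k" S f])
  then show ?case
    using Suc.IH by (simp only: Ck_on.simps(2)) blast
qed

text \<open>
  The form in which all closure properties are proved: a candidate derivative is enough, since
  on an open set it coincides with the unrestricted Frechet derivative.
\<close>

lemma Ck_on_SucI:
  assumes "open S" "\<And>x. x \<in> S \<Longrightarrow> (f has_derivative f' x) (at x)"
    and "\<And>v. Ck_on k S (\<lambda>x. f' x v)"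
  shows "Ck_on (Suc k) S f"
proof -
  have "Ck_on k S (\<lambda>x. dir_deriv f x v)" for v
    using Ck_on_cong[OF assms(1), of "\<lambda>x. dir_deriv f x v" "\<lambda>x. f' x v"] assms(2,3)
    by (simp add: dir_derivI)
  then show ?thesis
    using assms(2) by (auto simp: differentiable_def)
qed

lemma Ck_on_SucD:
  assumes "Ck_on (Suc k) S f" "x \<in> S"
  shows "(f has_derivative dir_deriv f x) (at x)"
  using assms frechet_derivative_works by auto

lemma Ck_on_const: "open S \<Longrightarrow> Ck_on k S (\<lambda>x. a)"
  by (induction k arbitrary: a) simp_all

lemma Ck_on_add:
  assumes "open S" "Ck_on k S f" "Ck_on k S g"
  shows "Ck_on k S (\<lambda>x. f x + g x)"
  using assms(2,3)
proof (induction k arbitrary: f g)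
  case 0
  then show ?case by (auto intro: continuous_intros)
next
  case (Suc k)
  show ?case
  proof (rule Ck_on_SucI[OF assms(1)])
    fix x assume "x \<in> S"
    then show "((\<lambda>x. f x + g x) has_derivative (\<lambda>v. dir_deriv f x v + dir_deriv g x v)) (at x)"
      using Suc.prems Ck_on_SucD has_derivative_add by blast
  qed (use Suc in auto)
qed

lemma Ck_on_mult:
  fixes f g :: "'a::real_normed_vector \<Rightarrow> real"
  assumes "open S" "Ck_on k S f" "Ck_on k S g"
  shows "Ck_on k S (\<lambda>x. f x * g x)"
  using assms(2,3)
proof (induction k arbitrary: f g)
  case 0
  then show ?case by (auto intro: continuous_intros)
next
  case (Suc k)
  show ?case
  proof (rule Ck_on_SucI[OF assms(1)])
    fix x assume "x \<in> S"
    then show "((\<lambda>x. f x * g x) has_derivative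
        (\<lambda>v. f x * dir_deriv g x v + dir_deriv f x v * g x)) (at x)"
      using Suc.prems Ck_on_SucD has_derivative_mult by blast
  next
    fix v
    show "Ck_on k S (\<lambda>x. f x * dir_deriv g x v + dir_deriv f x v * g x)"
      using Suc.prems Ck_on_Suc_imp[OF Suc.prems(1)] Ck_on_Suc_imp[OF Suc.prems(2)]
      by (intro Ck_on_add[OF assms(1)] Suc.IH) simp_all
  qed
qed

lemma Ck_on_inverse:
  fixes f :: "'a::real_normed_vector \<Rightarrow> real"
  assumes "open S" "Ck_on k S f" "\<And>x. x \<in> S \<Longrightarrow> f x \<noteq> 0"
  shows "Ck_on k S (\<lambda>x. inverse (f x))"
  using assms(2)
proof (induction k)
  case 0
  then show ?case using assms(3) by (auto intro: continuous_intros)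
next
  case (Suc k)
  show ?case
  proof (rule Ck_on_SucI[OF assms(1)])
    fix x assume "x \<in> S"
    then show "((\<lambda>x. inverse (f x)) has_derivative
        (\<lambda>v. (- 1) * (inverse (f x) * dir_deriv f x v * inverse (f x)))) (at x)"
      using Deriv.has_derivative_inverse[OF assms(3)[OF \<open>x \<in> S\<close>] Ck_on_SucD[OF Suc.prems]]
      by simp
  next
    fix v
    have "Ck_on k S (\<lambda>x. inverse (f x))" using Suc Ck_on_Suc_imp by blast
    then show "Ck_on k S (\<lambda>x. (- 1) * (inverse (f x) * dir_deriv f x v * inverse (f x)))"
      using Suc.prems by (intro Ck_on_mult[OF assms(1)] Ck_on_const assms(1)) auto
  qed
qed

lemma smooth_on_cong:
  assumes "open S" "\<And>x. x \<in> S \<Longrightarrow> f x = g x"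
  shows "smooth_on S f \<longleftrightarrow> smooth_on S g"
proof -
  have "Ck_on k S f \<longleftrightarrow> Ck_on k S g" for k by (rule Ck_on_cong[OF assms])
  then show ?thesis by (simp add: smooth_on_def)
qed

lemma smooth_on_const: "open S \<Longrightarrow> smooth_on S (\<lambda>x. a)"
  by (simp add: smooth_on_def Ck_on_const)

lemma smooth_on_add:
  "open S \<Longrightarrow> smooth_on S f \<Longrightarrow> smooth_on S g \<Longrightarrow> smooth_on S (\<lambda>x. f x + g x)"
  by (simp add: smooth_on_def Ck_on_add)

lemma smooth_on_mult:
  fixes f g :: "'a::real_normed_vector \<Rightarrow> real"
  shows "open S \<Longrightarrow> smooth_on S f \<Longrightarrow> smooth_on S g \<Longrightarrow> smooth_on S (\<lambda>x. f x * g x)"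
  by (simp add: smooth_on_def Ck_on_mult)

lemma smooth_on_inverse:
  fixes f :: "'a::real_normed_vector \<Rightarrow> real"
  shows "open S \<Longrightarrow> smooth_on S f \<Longrightarrow> (\<And>x. x \<in> S \<Longrightarrow> f x \<noteq> 0) \<Longrightarrow>
    smooth_on S (\<lambda>x. inverse (f x))"
  by (simp add: smooth_on_def Ck_on_inverse)

lemma smooth_on_diff:
  fixes f g :: "'a::real_normed_vector \<Rightarrow> real"
  assumes "open S" "smooth_on S f" "smooth_on S g"
  shows "smooth_on S (\<lambda>x. f x - g x)"
  using smooth_on_add[OF assms(1,2) smooth_on_mult[OF assms(1) smooth_on_const[of S "- 1"] assms(3)]]
    assms(1) by simp

lemma smooth_on_divide:
  fixes f g :: "'a::real_normed_vector \<Rightarrow> real"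
  assumes "open S" "smooth_on S f" "smooth_on S g" "\<And>x. x \<in> S \<Longrightarrow> g x \<noteq> 0"
  shows "smooth_on S (\<lambda>x. f x / g x)"
  using smooth_on_mult[OF assms(1,2) smooth_on_inverse[OF assms(1,3,4)]]
  by (simp add: divide_inverse)

lemma smooth_on_sum:
  assumes "open S" "\<And>i. i \<in> I \<Longrightarrow> smooth_on S (f i)"
  shows "smooth_on S (\<lambda>x. \<Sum>i\<in>I. f i x)"
  using assms(2)
  by (induction I rule: infinite_finite_induct)
    (simp_all add: smooth_on_const smooth_on_add assms(1))

lemma smooth_on_dir_deriv: "smooth_on S f \<Longrightarrow> smooth_on S (\<lambda>x. dir_deriv f x v)"
  unfolding smooth_on_def using Ck_on.simps(2) by blast

lemma smooth_on_imp_has_derivative: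
  "smooth_on S f \<Longrightarrow> x \<in> S \<Longrightarrow> (f has_derivative dir_deriv f x) (at x)"
  unfolding smooth_on_def using Ck_on_SucD by blast

lemma smooth_on_imp_continuous_on: "smooth_on S f \<Longrightarrow> continuous_on S f"
  unfolding smooth_on_def using Ck_on.simps(1) by blast

text \<open>
  The derivative \<open>f' / f\<close> no longer involves the logarithm, so one step of differentiation reduces
  the claim to products and inverses.
\<close>

lemma smooth_on_ln:
  fixes f :: "'a::real_normed_vector \<Rightarrow> real"
  assumes "open S" "smooth_on S f" "\<And>x. x \<in> S \<Longrightarrow> f x > 0"
  shows "smooth_on S (\<lambda>x. ln (f x))"
proof -
  have d: "((\<lambda>x. ln (f x)) has_derivative (\<lambda>v. dir_deriv f x v * inverse (f x))) (at x)"
    if "x \<in> S" for x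
    using has_derivative_ln[OF assms(3)[OF that] smooth_on_imp_has_derivative[OF assms(2) that]]
    by (simp add: mult.commute)
  have "Ck_on k S (\<lambda>x. ln (f x))" for k
  proof (cases k)
    case 0
    have "continuous_on S (\<lambda>x. ln (f x))"
      using smooth_on_imp_continuous_on[OF assms(2)] assms(3)
      by (intro continuous_on_ln) force+
    then show ?thesis by (simp add: 0)
  next
    case (Suc m)
    have "smooth_on S (\<lambda>x. dir_deriv f x v * inverse (f x))" for v
      using assms by (intro smooth_on_mult smooth_on_dir_deriv smooth_on_inverse) force+
    then show ?thesis
      unfolding Suc using d by (intro Ck_on_SucI[OF assms(1)]) (auto simp: smooth_on_def)
  qed
  then show ?thesis by (simp add: smooth_on_def)
qed

text \<open>
  Joint smoothness in parameter and point implies smoothness at each fixed parameter; the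
  derivative of the slice is again a slice, of the derivative in a direction \<open>(0, v)\<close>.
\<close>

lemma smooth_on_slice:
  fixes f :: "real \<times> 'e::real_normed_vector \<Rightarrow> 'b::real_normed_vector"
  assumes "open U" "smooth_on (UNIV \<times> U) f"
  shows "smooth_on U (\<lambda>x. f (t, x))"
proof -
  have "Ck_on k U (\<lambda>x. f (t, x))" if "smooth_on (UNIV \<times> U) f" for k
    using that
  proof (induction k arbitrary: f)
    case 0
    then show ?case
      using continuous_on_compose2[OF smooth_on_imp_continuous_on[OF 0], of U "\<lambda>x. (t, x)"]
      by (force intro: continuous_intros)
  next
    case (Suc k)
    show ?case
    proof (rule Ck_on_SucI[OF assms(1)])
      fix x assume "x \<in> U"
      then have "(f has_derivative dir_deriv f (t, x)) (at (t, x))"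
        using smooth_on_imp_has_derivative[OF Suc.prems] by auto
      then show "((\<lambda>x. f (t, x)) has_derivative (\<lambda>v. dir_deriv f (t, x) (0, v))) (at x)"
        by (rule has_derivative_compose[OF has_derivative_Pair[OF has_derivative_const has_derivative_ident]])
    next
      fix v
      show "Ck_on k U (\<lambda>x. dir_deriv f (t, x) (0, v))"
        using Suc.IH[OF smooth_on_dir_deriv[OF Suc.prems]] .
    qed
  qed
  then show ?thesis using assms(2) by (simp add: smooth_on_def)
qed

lemma dir_deriv_slice:
  assumes "smooth_on (UNIV \<times> U) f" "x \<in> U"
  shows "dir_deriv (\<lambda>y. f (t, y)) x v = dir_deriv f (t, x) (0, v)"
proof (rule dir_derivI)
  have "(f has_derivative dir_deriv f (t, x)) (at (t, x))"
    using smooth_on_imp_has_derivative[OF assms(1)] assms(2) by auto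
  then show "((\<lambda>y. f (t, y)) has_derivative (\<lambda>v. dir_deriv f (t, x) (0, v))) (at x)"
    by (rule has_derivative_compose[OF has_derivative_Pair[OF has_derivative_const has_derivative_ident]])
qed

lemma DERIV_time_slice:
  fixes f :: "real \<times> 'e::real_normed_vector \<Rightarrow> real"
  assumes "smooth_on (UNIV \<times> U) f" "x \<in> U"
  shows "((\<lambda>s. f (s, x)) has_real_derivative dir_deriv f (t, x) (1, 0)) (at t)"
proof -
  have d: "(f has_derivative dir_deriv f (t, x)) (at (t, x))"
    using smooth_on_imp_has_derivative[OF assms(1)] assms(2) by auto
  then have "((\<lambda>s. f (s, x)) has_derivative (\<lambda>r. dir_deriv f (t, x) (r, 0))) (at t)"
    by (rule has_derivative_compose[OF has_derivative_Pair[OF has_derivative_ident has_derivative_const]])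
  moreover have "(\<lambda>r. dir_deriv f (t, x) (r, 0)) = (*) (dir_deriv f (t, x) (1, 0))"
  proof
    fix r
    show "dir_deriv f (t, x) (r, 0) = dir_deriv f (t, x) (1, 0) * r"
      using linear_scale[OF has_derivative_linear[OF d], of r "(1, 0)"]
      by (simp add: scaleR_Pair mult.commute)
  qed
  ultimately show ?thesis by (simp only: has_field_derivative_def)
qed

text \<open>
  The mean value theorem, applied first in the direction \<open>u\<close> and then in the direction \<open>v\<close>. The
  left-hand side is symmetric in \<open>u\<close> and \<open>v\<close>, which is what makes second derivatives symmetric.
\<close>

lemma second_difference:
  fixes f :: "'a::real_normed_vector \<Rightarrow> real"
  assumes f: "smooth_on S f" and "h > 0"
    and S: "\<And>s r. 0 \<le> s \<Longrightarrow> s \<le> h \<Longrightarrow> 0 \<le> r \<Longrightarrow> r \<le> h \<Longrightarrow> x + s *\<^sub>R u + r *\<^sub>R v \<in> S"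
  obtains s r where "0 < s" "s < h" "0 < r" "r < h"
    "f (x + h *\<^sub>R u + h *\<^sub>R v) - f (x + h *\<^sub>R u) - f (x + h *\<^sub>R v) + f x =
     h * h * dir_deriv (\<lambda>y. dir_deriv f y u) (x + s *\<^sub>R u + r *\<^sub>R v) v"
proof -
  have line: "((\<lambda>s. g (p + s *\<^sub>R w)) has_real_derivative dir_deriv g (p + s *\<^sub>R w) w) (at s)"
    if "smooth_on S g" "p + s *\<^sub>R w \<in> S" for g :: "'a \<Rightarrow> real" and p w s
  proof -
    have d: "(g has_derivative dir_deriv g (p + s *\<^sub>R w)) (at (p + s *\<^sub>R w))"
      using smooth_on_imp_has_derivative[OF that] .
    have "((\<lambda>s. p + s *\<^sub>R w) has_derivative (\<lambda>r. r *\<^sub>R w)) (at s)"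
      by (auto intro!: derivative_eq_intros)
    from has_derivative_compose[OF this d]
    have "((\<lambda>s. g (p + s *\<^sub>R w)) has_derivative
        (\<lambda>r. dir_deriv g (p + s *\<^sub>R w) (r *\<^sub>R w))) (at s)" .
    then show ?thesis
      using linear_scale[OF has_derivative_linear[OF d]]
      by (simp add: has_field_derivative_def mult_commute_abs)
  qed
  let ?\<phi> = "\<lambda>s. f ((x + h *\<^sub>R v) + s *\<^sub>R u) - f (x + s *\<^sub>R u)"
  let ?\<phi>' = "\<lambda>s. dir_deriv f ((x + h *\<^sub>R v) + s *\<^sub>R u) u - dir_deriv f (x + s *\<^sub>R u) u"
  have "(?\<phi> has_real_derivative ?\<phi>' s) (at s)" if "0 \<le> s" "s \<le> h" for s
    using S[of s h] S[of s 0] that \<open>h > 0\<close>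
    by (intro DERIV_diff line f) (simp_all add: algebra_simps)
  then obtain s where s: "0 < s" "s < h" "?\<phi> h - ?\<phi> 0 = h * ?\<phi>' s"
    using MVT2[OF \<open>h > 0\<close>, of ?\<phi> ?\<phi>'] by auto
  let ?\<psi> = "\<lambda>r. dir_deriv f ((x + s *\<^sub>R u) + r *\<^sub>R v) u"
  let ?\<psi>' = "\<lambda>r. dir_deriv (\<lambda>y. dir_deriv f y u) ((x + s *\<^sub>R u) + r *\<^sub>R v) v"
  have "(?\<psi> has_real_derivative ?\<psi>' r) (at r)" if "0 \<le> r" "r \<le> h" for r
    using S[of s r] that s by (intro line smooth_on_dir_deriv f) auto
  then obtain r where r: "0 < r" "r < h" "?\<psi> h - ?\<psi> 0 = h * ?\<psi>' r"
    using MVT2[OF \<open>h > 0\<close>, of ?\<psi> ?\<psi>'] by auto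
  show ?thesis
  proof (rule that[OF s(1,2) r(1,2)])
    have "?\<phi>' s = h * ?\<psi>' r" using r(3) by (simp add: algebra_simps)
    with s(3) show "f (x + h *\<^sub>R u + h *\<^sub>R v) - f (x + h *\<^sub>R u) - f (x + h *\<^sub>R v) + f x =
     h * h * dir_deriv (\<lambda>y. dir_deriv f y u) (x + s *\<^sub>R u + r *\<^sub>R v) v"
      by (simp add: algebra_simps)
  qed
qed

text \<open>
  The second difference over a small parallelogram equals both mixed second derivatives, up to
  moving the base point inside the parallelogram; continuity at \<open>x\<close> removes the displacement.
\<close>

lemma second_derivative_symmetric_real:
  fixes f :: "'a::real_normed_vector \<Rightarrow> real"
  assumes f: "smooth_on S f" and S: "open S" "x \<in> S"
  shows "dir_deriv (\<lambda>y. dir_deriv f y u) x v = dir_deriv (\<lambda>y. dir_deriv f y v) x u"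
proof -
  let ?P = "\<lambda>y. dir_deriv (\<lambda>y. dir_deriv f y u) y v"
  let ?Q = "\<lambda>y. dir_deriv (\<lambda>y. dir_deriv f y v) y u"
  have near: "\<bar>?P x - ?Q x\<bar> \<le> e" if "e > 0" for e
  proof -
    have "continuous (at x) ?P" "continuous (at x) ?Q"
      using smooth_on_imp_continuous_on[OF smooth_on_dir_deriv[OF smooth_on_dir_deriv[OF f]]] S
      by (auto simp: continuous_on_eq_continuous_at)
    obtain d1 where d1: "d1 > 0" "\<And>y. dist y x < d1 \<Longrightarrow> dist (?P y) (?P x) < e / 2"
      using \<open>continuous (at x) ?P\<close> half_gt_zero[OF \<open>e > 0\<close>]
      unfolding continuous_at_eps_delta by blast
    obtain d2 where d2: "d2 > 0" "\<And>y. dist y x < d2 \<Longrightarrow> dist (?Q y) (?Q x) < e / 2"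
      using \<open>continuous (at x) ?Q\<close> half_gt_zero[OF \<open>e > 0\<close>]
      unfolding continuous_at_eps_delta by blast
    obtain d3 where d3: "d3 > 0" "ball x d3 \<subseteq> S" using S openE by blast
    define d where "d = min d1 (min d2 d3)"
    have "d > 0" using d1 d2 d3 by (simp add: d_def)
    \<comment> \<open>small enough for the parallelogram with sides \<open>h u\<close> and \<open>h v\<close> to lie in \<open>ball x d\<close>\<close>
    define h where "h = d / (2 * (norm u + norm v + 1))"
    have pos: "norm u + norm v + 1 > 0" by (simp add: add_nonneg_pos)
    have "h > 0" using \<open>d > 0\<close> pos by (simp add: h_def)
    have near: "dist (x + s *\<^sub>R u + r *\<^sub>R v) x < d" if "0 \<le> s" "s \<le> h" "0 \<le> r" "r \<le> h" for s r
    proof -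
      have "dist (x + s *\<^sub>R u + r *\<^sub>R v) x = norm (s *\<^sub>R u + r *\<^sub>R v)" by (simp add: dist_norm)
      also have "\<dots> \<le> s * norm u + r * norm v" using norm_triangle_ineq[of "s *\<^sub>R u" "r *\<^sub>R v"] that by simp
      also have "\<dots> \<le> h * norm u + h * norm v" using that by (intro add_mono mult_right_mono) auto
      also have "\<dots> < h * (2 * (norm u + norm v + 1))"
      proof -
        have "norm u + norm v < 2 * (norm u + norm v + 1)" by (smt (verit) norm_ge_zero)
        then show ?thesis using \<open>h > 0\<close> mult_strict_left_mono by (fastforce simp: algebra_simps)
      qed
      also have "\<dots> = d" using pos by (simp add: h_def)
      finally show ?thesis .
    qed
    then have inS: "x + s *\<^sub>R u + r *\<^sub>R v \<in> S" if "0 \<le> s" "s \<le> h" "0 \<le> r" "r \<le> h" for s r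
      using that d3(2) by (force simp: d_def dist_commute)
    obtain s r where sr: "0 < s" "s < h" "0 < r" "r < h"
      "f (x + h *\<^sub>R u + h *\<^sub>R v) - f (x + h *\<^sub>R u) - f (x + h *\<^sub>R v) + f x =
       h * h * ?P (x + s *\<^sub>R u + r *\<^sub>R v)"
      using second_difference[OF f \<open>h > 0\<close> inS] by blast
    have inS': "x + s *\<^sub>R v + r *\<^sub>R u \<in> S" if "0 \<le> s" "s \<le> h" "0 \<le> r" "r \<le> h" for s r
      using inS[of r s] that by (simp add: algebra_simps)
    obtain s' r' where sr': "0 < s'" "s' < h" "0 < r'" "r' < h"
      "f (x + h *\<^sub>R v + h *\<^sub>R u) - f (x + h *\<^sub>R v) - f (x + h *\<^sub>R u) + f x =
       h * h * ?Q (x + s' *\<^sub>R v + r' *\<^sub>R u)"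
      using second_difference[OF f \<open>h > 0\<close> inS'] by blast
    have "h * h * ?P (x + s *\<^sub>R u + r *\<^sub>R v) = h * h * ?Q (x + r' *\<^sub>R u + s' *\<^sub>R v)"
      using sr(5) sr'(5) by (simp add: algebra_simps)
    then have "?P (x + s *\<^sub>R u + r *\<^sub>R v) = ?Q (x + r' *\<^sub>R u + s' *\<^sub>R v)"
      using \<open>h > 0\<close> by simp
    moreover have "dist (?P (x + s *\<^sub>R u + r *\<^sub>R v)) (?P x) < e / 2"
      using near[of s r] sr by (intro d1(2)) (simp add: d_def)
    moreover have "dist (?Q (x + r' *\<^sub>R u + s' *\<^sub>R v)) (?Q x) < e / 2"
      using near[of r' s'] sr' by (intro d2(2)) (simp add: d_def)
    ultimately show ?thesis unfolding dist_real_def by linarith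
  qed
  have "\<bar>?P x - ?Q x\<bar> \<le> 0" by (rule field_le_epsilon) (use near in simp)
  then show ?thesis by simp
qed

lemma second_derivative_symmetric:
  fixes f :: "'a::real_normed_vector \<Rightarrow> 'b::euclidean_space"
  assumes f: "smooth_on S f" and S: "open S" "x \<in> S"
  shows "dir_deriv (\<lambda>y. dir_deriv f y u) x v = dir_deriv (\<lambda>y. dir_deriv f y v) x u"
proof (rule euclidean_eqI)
  fix b :: 'b assume "b \<in> Basis"
  have comp: "dir_deriv (\<lambda>y. g y \<bullet> b) y w = dir_deriv g y w \<bullet> b"
    if "smooth_on S g" "y \<in> S" for g :: "'a \<Rightarrow> 'b" and y w
    using smooth_on_imp_has_derivative[OF that] by (intro dir_derivI has_derivative_inner_left)
  have "Ck_on k S (\<lambda>y. g y \<bullet> b)" if "smooth_on S g" for k and g :: "'a \<Rightarrow> 'b"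
    using that
  proof (induction k arbitrary: g)
    case 0
    then show ?case using smooth_on_imp_continuous_on by (auto intro!: continuous_intros)
  next
    case (Suc k)
    show ?case
    proof (rule Ck_on_SucI[OF S(1)])
      fix y assume "y \<in> S"
      then show "((\<lambda>y. g y \<bullet> b) has_derivative (\<lambda>v. dir_deriv g y v \<bullet> b)) (at y)"
        using smooth_on_imp_has_derivative[OF Suc.prems] by (intro has_derivative_inner_left)
    next
      fix v
      show "Ck_on k S (\<lambda>y. dir_deriv g y v \<bullet> b)"
        using Suc.IH[OF smooth_on_dir_deriv[OF Suc.prems]] .
    qed
  qed
  then have fb: "smooth_on S (\<lambda>y. f y \<bullet> b)" using f by (simp add: smooth_on_def)
  have "dir_deriv (\<lambda>y. dir_deriv f y u) x v \<bullet> b = dir_deriv (\<lambda>y. dir_deriv (\<lambda>y. f y \<bullet> b) y u) x v"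
    for u v
  proof -
    have "dir_deriv (\<lambda>y. dir_deriv (\<lambda>y. f y \<bullet> b) y u) x v = dir_deriv (\<lambda>y. dir_deriv f y u \<bullet> b) x v"
      using comp[OF f] by (subst frechet_derivative_cong_open[OF S, of _ "\<lambda>y. dir_deriv f y u \<bullet> b"]) auto
    also have "\<dots> = dir_deriv (\<lambda>y. dir_deriv f y u) x v \<bullet> b"
      by (rule comp[OF smooth_on_dir_deriv[OF f] S(2)])
    finally show ?thesis by simp
  qed
  then show "dir_deriv (\<lambda>y. dir_deriv f y u) x v \<bullet> b = dir_deriv (\<lambda>y. dir_deriv f y v) x u \<bullet> b"
    using second_derivative_symmetric_real[OF fb S] by simp
qed

section \<open>Alternating multilinear maps and the wedge product\<close>

lemma alternating_cong:
  "alternating_multilinear k f \<Longrightarrow> (\<And>i. i < k \<Longrightarrow> v i = w i) \<Longrightarrow> f v = f w"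
  by (simp add: alternating_multilinear_def)

lemma alternating_linear:
  "alternating_multilinear k f \<Longrightarrow> i < k \<Longrightarrow> linear (\<lambda>u. f (v(i := u)))"
  by (simp add: alternating_multilinear_def)

lemma alternating_eq_0:
  "alternating_multilinear k f \<Longrightarrow> i < k \<Longrightarrow> j < k \<Longrightarrow> i \<noteq> j \<Longrightarrow> v i = v j \<Longrightarrow> f v = 0"
  unfolding alternating_multilinear_def by metis

lemma alternating_multilinear_lincomb:
  fixes f g :: "(nat \<Rightarrow> 'e::real_vector) \<Rightarrow> real"
  assumes "alternating_multilinear k f" "alternating_multilinear k g"
  shows "alternating_multilinear k (\<lambda>v. a * f v + b * g v)"
  unfolding alternating_multilinear_def
proof (intro conjI allI impI)
  fix v w :: "nat \<Rightarrow> 'e" assume "\<forall>i<k. v i = w i"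
  then show "a * f v + b * g v = a * f w + b * g w"
    using alternating_cong[OF assms(1)] alternating_cong[OF assms(2)] by metis
next
  fix i v assume "i < k"
  note l = alternating_linear[OF assms(1) this] alternating_linear[OF assms(2) this]
  show "linear (\<lambda>u. a * f (v(i := u)) + b * g (v(i := u)))"
    by (rule linearI) (simp_all add: linear_add[OF l(1)] linear_add[OF l(2)]
        linear_scale[OF l(1)] linear_scale[OF l(2)] algebra_simps)
next
  fix v :: "nat \<Rightarrow> 'e" and i j assume "i < k" "j < k" "i \<noteq> j \<and> v i = v j"
  then have "f v = 0" "g v = 0"
    using alternating_eq_0[OF assms(1)] alternating_eq_0[OF assms(2)] by metis+
  then show "a * f v + b * g v = 0" by simp
qed

text \<open>
  For linearity, the slot \<open>i\<close> is fed by \<open>\<sigma>\<close> into exactly one argument of one of the two factors.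
  For alternation, composing every \<open>\<sigma>\<close> with the transposition of two slots that hold equal vectors
  permutes the summands and changes their sign, so the sum equals its own negative.
\<close>

lemma alternating_multilinear_wedge:
  fixes \<omega> \<eta> :: "('a, 'e::real_vector) form"
  assumes \<omega>: "alternating_multilinear k (\<omega> c x)" and \<eta>: "alternating_multilinear l (\<eta> c x)"
  shows "alternating_multilinear (k + l) (wedge k l \<omega> \<eta> c x)"
  unfolding alternating_multilinear_def
proof (intro conjI allI impI)
  fix v w :: "nat \<Rightarrow> 'e" assume eq: "\<forall>i<k + l. v i = w i"
  have vw: "v (\<sigma> i) = w (\<sigma> i)" if "\<sigma> permutes {..<k + l}" "i < k + l" for \<sigma> i
    using eq that permutes_in_image[OF that(1), of i] by simp
  have "\<omega> c x (\<lambda>i. v (\<sigma> i)) = \<omega> c x (\<lambda>i. w (\<sigma> i))" if "\<sigma> permutes {..<k + l}" for \<sigma>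
    by (rule alternating_cong[OF \<omega>]) (simp add: vw[OF that])
  moreover have "\<eta> c x (\<lambda>i. v (\<sigma> (k + i))) = \<eta> c x (\<lambda>i. w (\<sigma> (k + i)))"
    if "\<sigma> permutes {..<k + l}" for \<sigma>
    by (rule alternating_cong[OF \<eta>]) (simp add: vw[OF that])
  ultimately show "wedge k l \<omega> \<eta> c x v = wedge k l \<omega> \<eta> c x w"
    unfolding wedge_def by simp
next
  fix i v assume "i < k + l"
  have term_linear: "linear (\<lambda>u. of_int (sign \<sigma>) * \<omega> c x (\<lambda>m. (v(i := u)) (\<sigma> m))
      * \<eta> c x (\<lambda>m. (v(i := u)) (\<sigma> (k + m))))" (is "linear ?f")
    if \<sigma>: "\<sigma> permutes {..<k + l}" for \<sigma>
  proof -
    define j where "j = inv \<sigma> i"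
    have j: "\<sigma> m = i \<longleftrightarrow> m = j" for m
      unfolding j_def using permutes_inverses[OF \<sigma>] by metis
    have "j < k + l"
      using \<open>i < k + l\<close> permutes_in_image[OF \<sigma>, of j] j[of j] by simp
    have 1: "(\<lambda>m. (v(i := u)) (\<sigma> m)) = (\<lambda>m. v (\<sigma> m))(j := u)" for u
      using j by (auto simp: fun_eq_iff)
    show ?thesis
    proof (cases "j < k")
      case True
      then have 2: "(\<lambda>m. (v(i := u)) (\<sigma> (k + m))) = (\<lambda>m. v (\<sigma> (k + m)))" for u
        using j by (auto simp: fun_eq_iff)
      note l = alternating_linear[OF \<omega> True, of "\<lambda>m. v (\<sigma> m)"]
      show ?thesis
        unfolding 1 2
        by (rule linearI) (simp_all add: linear_add[OF l] linear_scale[OF l] ring_distribs mult_ac)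
    next
      case False
      then have 2: "(\<lambda>m. (v(i := u)) (\<sigma> (k + m))) = (\<lambda>m. v (\<sigma> (k + m)))(j - k := u)" for u
        using j by (auto simp: fun_eq_iff)
      have 3: "\<omega> c x ((\<lambda>m. v (\<sigma> m))(j := u)) = \<omega> c x (\<lambda>m. v (\<sigma> m))" for u
        using False by (intro alternating_cong[OF \<omega>]) auto
      have "j - k < l" using \<open>j < k + l\<close> False by auto
      note l = alternating_linear[OF \<eta> this, of "\<lambda>m. v (\<sigma> (k + m))"]
      show ?thesis
        unfolding 1 2 3
        by (rule linearI) (simp_all add: linear_add[OF l] linear_scale[OF l] ring_distribs mult_ac)
    qed
  qed
  have l: "linear (\<lambda>u. \<Sum>\<sigma> | \<sigma> permutes {..<k + l}. of_int (sign \<sigma>)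
      * \<omega> c x (\<lambda>m. (v(i := u)) (\<sigma> m)) * \<eta> c x (\<lambda>m. (v(i := u)) (\<sigma> (k + m))))"
    using term_linear by (intro linear_compose_sum) blast
  show "linear (\<lambda>u. wedge k l \<omega> \<eta> c x (v(i := u)))"
    unfolding wedge_def
    by (rule linearI) (simp_all only: linear_add[OF l] linear_scale[OF l] add_divide_distrib
        real_scaleR_def times_divide_eq_right)
next
  fix v :: "nat \<Rightarrow> 'e" and i j assume ij: "i < k + l" "j < k + l" "i \<noteq> j \<and> v i = v j"
  let ?S = "{..<k + l}"
  let ?G = "\<lambda>\<sigma>. of_int (sign \<sigma>) * \<omega> c x (\<lambda>i. v (\<sigma> i)) * \<eta> c x (\<lambda>i. v (\<sigma> (k + i)))"
  let ?\<tau> = "Transposition.transpose i j"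
  have \<tau>: "?\<tau> permutes ?S" using ij by (intro permutes_swap_id) auto
  have v: "v (?\<tau> m) = v m" for m using ij by (auto simp: Transposition.transpose_def)
  have "sum ?G {\<sigma>. \<sigma> permutes ?S} = sum (\<lambda>\<sigma>. ?G (?\<tau> \<circ> \<sigma>)) {\<sigma>. \<sigma> permutes ?S}"
    by (rule setum_permutations_compose_left[OF \<tau>])
  also have "\<dots> = sum (\<lambda>\<sigma>. - ?G \<sigma>) {\<sigma>. \<sigma> permutes ?S}"
  proof (rule sum.cong)
    fix \<sigma> assume "\<sigma> \<in> {\<sigma>. \<sigma> permutes ?S}"
    then have "permutation ?\<tau>" "permutation \<sigma>"
      using \<tau> by (auto intro: permutes_imp_permutation[OF finite_lessThan])
    then have "sign (?\<tau> \<circ> \<sigma>) = - sign \<sigma>"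
      using ij by (simp add: sign_compose sign_swap_id)
    moreover have "v ((?\<tau> \<circ> \<sigma>) m) = v (\<sigma> m)" for m
      unfolding comp_def by (rule v)
    ultimately show "?G (?\<tau> \<circ> \<sigma>) = - ?G \<sigma>"
      by (simp only: of_int_minus mult_minus_left)
  qed simp
  finally show "wedge k l \<omega> \<eta> c x v = 0"
    by (simp add: wedge_def sum_negf)
qed

section \<open>Charts and transition maps\<close>

locale smooth_atlas =
  fixes M :: "'a topology" and A :: "('a, 'e::euclidean_space) chart set"
  assumes smooth_structure: "smooth_structure M A"
begin

lemma chart: "c \<in> A \<Longrightarrow> is_chart M c"
  using smooth_structure by (simp add: smooth_structure_def)

lemma open_codom [simp]: "c \<in> A \<Longrightarrow> open (codom c)"
  using chart by (simp add: is_chart_def)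

lemma open_cylinder: "c \<in> A \<Longrightarrow> open (UNIV \<times> codom c)"
  by (simp add: open_Times)

lemma chart_topspace: "c \<in> A \<Longrightarrow> topspace (subtopology M (fst c)) = fst c"
  using chart[of c] openin_subset[of M "fst c"] by (auto simp: is_chart_def)

lemma open_overlap:
  assumes "c \<in> A" "d \<in> A"
  shows "open (overlap c d)"
proof -
  have "openin (subtopology M (fst c)) (fst c \<inter> fst d)"
    using chart[OF assms(1)] chart[OF assms(2)]
    by (auto simp: is_chart_def openin_subtopology)
  moreover have "open_map (subtopology M (fst c)) (top_of_set (codom c)) (snd c)"
    using chart[OF assms(1)] homeomorphic_imp_open_map by (auto simp: is_chart_def)
  ultimately have "openin (top_of_set (codom c)) (overlap c d)"
    by (auto simp: overlap_def open_map_def)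
  then show ?thesis
    using open_codom[OF assms(1)] openin_open_trans by blast
qed

lemma overlap_subset_codom: "overlap c d \<subseteq> codom c"
  by (auto simp: overlap_def codom_def)

lemma transition_in_codom:
  assumes "c \<in> A" "x \<in> overlap c d"
  shows "transition c d x \<in> codom d"
proof -
  obtain p where p: "p \<in> fst c" "p \<in> fst d" "x = snd c p"
    using assms(2) by (auto simp: overlap_def)
  have "inj_on (snd c) (fst c)"
    using chart[OF assms(1)] homeomorphic_imp_injective_map[of "subtopology M (fst c)" _ "snd c"]
    unfolding chart_topspace[OF assms(1)] is_chart_def by blast
  then have "chart_inv c x = p" using p by (simp add: chart_inv_def)
  then show ?thesis using p by (simp add: transition_def codom_def)
qed

lemma smooth_transition: "c \<in> A \<Longrightarrow> d \<in> A \<Longrightarrow> smooth_on (overlap c d) (transition c d)"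
  using smooth_structure by (simp add: smooth_structure_def smoothly_compatible_def)

section \<open>Smooth families of differential forms\<close>

lemma k_form_alternating:
  "k_form A k \<omega> \<Longrightarrow> c \<in> A \<Longrightarrow> x \<in> codom c \<Longrightarrow> alternating_multilinear k (\<omega> c x)"
  by (simp add: k_form_def)

lemma k_form_smooth: "k_form A k \<omega> \<Longrightarrow> c \<in> A \<Longrightarrow> smooth_on (codom c) (\<lambda>x. \<omega> c x v)"
  by (simp add: k_form_def)

lemma k_form_natural:
  "k_form A k \<omega> \<Longrightarrow> c \<in> A \<Longrightarrow> d \<in> A \<Longrightarrow> x \<in> overlap c d \<Longrightarrow>
   \<omega> c x v = \<omega> d (transition c d x) (\<lambda>i. dir_deriv (transition c d) x (v i))"
  by (simp add: k_form_def)

lemma k_form_has_derivative: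
  "k_form A k \<omega> \<Longrightarrow> c \<in> A \<Longrightarrow> x \<in> codom c \<Longrightarrow>
   ((\<lambda>y. \<omega> c y v) has_derivative dir_deriv (\<lambda>y. \<omega> c y v) x) (at x)"
  using smooth_on_imp_has_derivative[OF k_form_smooth] .

lemma k_form_lincomb:
  assumes "k_form A k \<omega>" "k_form A k \<eta>"
  shows "k_form A k (\<lambda>c x v. a * \<omega> c x v + b * \<eta> c x v)"
  unfolding k_form_def
proof (intro conjI ballI allI)
  fix c x assume "c \<in> A" "x \<in> codom c"
  then show "alternating_multilinear k (\<lambda>v. a * \<omega> c x v + b * \<eta> c x v)"
    using assms by (intro alternating_multilinear_lincomb k_form_alternating)
next
  fix c v assume "c \<in> A"
  then show "smooth_on (codom c) (\<lambda>x. a * \<omega> c x v + b * \<eta> c x v)"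
    using assms by (intro smooth_on_add smooth_on_mult smooth_on_const k_form_smooth) auto
next
  fix c d x v assume cd: "c \<in> A" "d \<in> A" "x \<in> overlap c d"
  show "a * \<omega> c x v + b * \<eta> c x v =
    a * \<omega> d (transition c d x) (\<lambda>i. dir_deriv (transition c d) x (v i)) +
    b * \<eta> d (transition c d x) (\<lambda>i. dir_deriv (transition c d) x (v i))"
    unfolding k_form_natural[OF assms(1) cd] k_form_natural[OF assms(2) cd] ..
qed

lemma family_joint_smooth:
  assumes "smooth_form_family A k \<omega>" "c \<in> A"
  shows "smooth_on (UNIV \<times> codom c) (\<lambda>p. \<omega> (fst p) c (snd p) v)"
  using assms by (simp add: smooth_form_family_def split_beta')

lemma family_k_form: "smooth_form_family A k \<omega> \<Longrightarrow> k_form A k (\<omega> t)"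
  by (simp add: smooth_form_family_def)

text \<open>
  Smoothness at each single parameter value follows from joint smoothness
  by slicing, so the three conditions below are all that a family has to satisfy.
\<close>

lemma smooth_form_familyI:
  assumes alt: "\<And>t c x. c \<in> A \<Longrightarrow> x \<in> codom c \<Longrightarrow> alternating_multilinear k (\<omega> t c x)"
    and smooth: "\<And>c v. c \<in> A \<Longrightarrow> smooth_on (UNIV \<times> codom c) (\<lambda>p. \<omega> (fst p) c (snd p) v)"
    and natural: "\<And>t c d x v. c \<in> A \<Longrightarrow> d \<in> A \<Longrightarrow> x \<in> overlap c d \<Longrightarrow>
      \<omega> t c x v = \<omega> t d (transition c d x) (\<lambda>i. dir_deriv (transition c d) x (v i))"
  shows "smooth_form_family A k \<omega>"
  unfolding smooth_form_family_def k_form_def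
proof (intro conjI allI ballI)
  fix t c v assume "c \<in> A"
  show "smooth_on (codom c) (\<lambda>x. \<omega> t c x v)"
    using smooth_on_slice[OF open_codom[OF \<open>c \<in> A\<close>] smooth[OF \<open>c \<in> A\<close>], of t v] by simp
next
  fix t c d x v assume "c \<in> A" "d \<in> A" "x \<in> overlap c d"
  then show "\<omega> t c x v = \<omega> t d (transition c d x) (\<lambda>i. dir_deriv (transition c d) x (v i))"
    by (rule natural)
qed (use alt smooth in \<open>simp_all add: split_beta'\<close>)

definition form_add :: "('a, 'e) form \<Rightarrow> ('a, 'e) form \<Rightarrow> ('a, 'e) form" where
  "form_add \<omega> \<eta> = (\<lambda>c x v. \<omega> c x v + \<eta> c x v)"

definition form_scale :: "(('a, 'e) chart \<Rightarrow> 'e \<Rightarrow> real) \<Rightarrow> ('a, 'e) form \<Rightarrow> ('a, 'e) form" where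
  "form_scale f \<omega> = (\<lambda>c x v. f c x * \<omega> c x v)"

definition func_form :: "(('a, 'e) chart \<Rightarrow> 'e \<Rightarrow> real) \<Rightarrow> ('a, 'e) form" where
  "func_form f = (\<lambda>c x v. f c x)"

lemma family_form_add:
  assumes "smooth_form_family A k \<omega>" "smooth_form_family A k \<eta>"
  shows "smooth_form_family A k (\<lambda>t. form_add (\<omega> t) (\<eta> t))"
proof (rule smooth_form_familyI)
  fix c v assume "c \<in> A"
  then show "smooth_on (UNIV \<times> codom c) (\<lambda>p. form_add (\<omega> (fst p)) (\<eta> (fst p)) c (snd p) v)"
    unfolding form_add_def using assms by (intro smooth_on_add family_joint_smooth open_cylinder)
next
  fix t c x assume "c \<in> A" "x \<in> codom c"
  then show "alternating_multilinear k (form_add (\<omega> t) (\<eta> t) c x)"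
    using k_form_alternating[OF k_form_lincomb[OF family_k_form[OF assms(1)] family_k_form[OF assms(2)]],
        of c x 1 t 1 t]
    by (simp add: form_add_def)
next
  fix t c d x v assume cd: "c \<in> A" "d \<in> A" "x \<in> overlap c d"
  show "form_add (\<omega> t) (\<eta> t) c x v =
    form_add (\<omega> t) (\<eta> t) d (transition c d x) (\<lambda>i. dir_deriv (transition c d) x (v i))"
    unfolding form_add_def k_form_natural[OF family_k_form[OF assms(1)] cd]
      k_form_natural[OF family_k_form[OF assms(2)] cd] ..
qed

lemma family_form_scale:
  assumes f: "smooth_form_family A 0 (\<lambda>t. func_form (f t))" and \<omega>: "smooth_form_family A k \<omega>"
  shows "smooth_form_family A k (\<lambda>t. form_scale (f t) (\<omega> t))"
proof (rule smooth_form_familyI)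
  fix c v assume "c \<in> A"
  then show "smooth_on (UNIV \<times> codom c) (\<lambda>p. form_scale (f (fst p)) (\<omega> (fst p)) c (snd p) v)"
    unfolding form_scale_def
    using family_joint_smooth[OF f \<open>c \<in> A\<close>]
    by (intro smooth_on_mult family_joint_smooth[OF \<omega>] open_cylinder) (simp_all add: func_form_def)
next
  fix t c x assume "c \<in> A" "x \<in> codom c"
  then show "alternating_multilinear k (form_scale (f t) (\<omega> t) c x)"
    using alternating_multilinear_lincomb[of k "\<omega> t c x" "\<omega> t c x" "f t c x" 0]
      k_form_alternating[OF family_k_form[OF \<omega>]]
    by (simp add: form_scale_def)
next
  fix t c d x v assume cd: "c \<in> A" "d \<in> A" "x \<in> overlap c d"
  show "form_scale (f t) (\<omega> t) c x v =
    form_scale (f t) (\<omega> t) d (transition c d x) (\<lambda>i. dir_deriv (transition c d) x (v i))"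
    unfolding form_scale_def k_form_natural[OF family_k_form[OF \<omega>] cd]
    using k_form_natural[OF family_k_form[OF f] cd] by (simp only: func_form_def)
qed

lemma family_wedge:
  assumes \<omega>: "smooth_form_family A k \<omega>" and \<eta>: "smooth_form_family A l \<eta>"
  shows "smooth_form_family A (k + l) (\<lambda>t. wedge k l (\<omega> t) (\<eta> t))"
proof (rule smooth_form_familyI)
  fix c v assume c: "c \<in> A"
  show "smooth_on (UNIV \<times> codom c) (\<lambda>p. wedge k l (\<omega> (fst p)) (\<eta> (fst p)) c (snd p) v)"
    unfolding wedge_def divide_inverse
    by (intro smooth_on_sum smooth_on_mult smooth_on_const family_joint_smooth[OF \<omega> c]
        family_joint_smooth[OF \<eta> c] open_cylinder[OF c])
next
  fix t c x assume "c \<in> A" "x \<in> codom c"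
  then show "alternating_multilinear (k + l) (wedge k l (\<omega> t) (\<eta> t) c x)"
    by (intro alternating_multilinear_wedge k_form_alternating family_k_form[OF \<omega>] family_k_form[OF \<eta>])
next
  fix t c d x v assume cd: "c \<in> A" "d \<in> A" "x \<in> overlap c d"
  show "wedge k l (\<omega> t) (\<eta> t) c x v =
    wedge k l (\<omega> t) (\<eta> t) d (transition c d x) (\<lambda>i. dir_deriv (transition c d) x (v i))"
    unfolding wedge_def k_form_natural[OF family_k_form[OF \<omega>] cd]
      k_form_natural[OF family_k_form[OF \<eta>] cd] ..
qed

lemma form_dot_eq_dir_deriv:
  assumes "smooth_form_family A k \<omega>" "c \<in> A" "x \<in> codom c"
  shows "form_dot \<omega> t c x v = dir_deriv (\<lambda>p. \<omega> (fst p) c (snd p) v) (t, x) (1, 0)"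
  using DERIV_time_slice[OF family_joint_smooth[OF assms(1,2)] assms(3)]
  by (simp add: form_dot_def DERIV_imp_deriv)

lemma family_DERIV:
  assumes "smooth_form_family A k \<omega>" "c \<in> A" "x \<in> codom c"
  shows "((\<lambda>s. \<omega> s c x v) has_real_derivative form_dot \<omega> t c x v) (at t)"
  using DERIV_time_slice[OF family_joint_smooth[OF assms(1,2)] assms(3)]
  by (simp add: form_dot_eq_dir_deriv[OF assms])

lemma dir_deriv_eq_joint:
  assumes "smooth_form_family A k \<omega>" "c \<in> A" "x \<in> codom c"
  shows "dir_deriv (\<lambda>y. \<omega> t c y v) x u = dir_deriv (\<lambda>p. \<omega> (fst p) c (snd p) v) (t, x) (0, u)"
  using dir_deriv_slice[OF family_joint_smooth[OF assms(1,2), of v] assms(3), of t u] by simp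

lemma family_form_dot:
  assumes \<omega>: "smooth_form_family A k \<omega>"
  shows "smooth_form_family A k (form_dot \<omega>)"
proof (rule smooth_form_familyI)
  fix c v assume c: "c \<in> A"
  have "smooth_on (UNIV \<times> codom c) (\<lambda>p. dir_deriv (\<lambda>p. \<omega> (fst p) c (snd p) v) p (1, 0))"
    by (rule smooth_on_dir_deriv[OF family_joint_smooth[OF \<omega> c]])
  then show "smooth_on (UNIV \<times> codom c) (\<lambda>p. form_dot \<omega> (fst p) c (snd p) v)"
    by (rule smooth_on_cong[OF open_cylinder[OF c], THEN iffD2, rotated])
      (auto simp: form_dot_eq_dir_deriv[OF \<omega> c])
next
  fix t c x assume cx: "c \<in> A" "x \<in> codom c"
  note alt = k_form_alternating[OF family_k_form[OF \<omega>] cx]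
  note D = family_DERIV[OF \<omega> cx]
  show "alternating_multilinear k (form_dot \<omega> t c x)"
    unfolding alternating_multilinear_def
  proof (intro conjI allI impI)
    fix v w :: "nat \<Rightarrow> 'e" assume "\<forall>i<k. v i = w i"
    then have "\<omega> s c x v = \<omega> s c x w" for s by (intro alternating_cong[OF alt]) auto
    then show "form_dot \<omega> t c x v = form_dot \<omega> t c x w" by (simp add: form_dot_def)
  next
    fix i v assume i: "i < k"
    show "linear (\<lambda>u. form_dot \<omega> t c x (v(i := u)))"
    proof (rule linearI)
      fix u w
      have s: "\<omega> s c x (v(i := u + w)) = \<omega> s c x (v(i := u)) + \<omega> s c x (v(i := w))" for s
        using linear_add[OF alternating_linear[OF alt i]] .
      have "((\<lambda>s. \<omega> s c x (v(i := u)) + \<omega> s c x (v(i := w))) has_real_derivative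
          form_dot \<omega> t c x (v(i := u)) + form_dot \<omega> t c x (v(i := w))) (at t)"
        by (rule DERIV_add[OF D D])
      then show "form_dot \<omega> t c x (v(i := u + w)) =
          form_dot \<omega> t c x (v(i := u)) + form_dot \<omega> t c x (v(i := w))"
        unfolding form_dot_def[of \<omega> t] s by (rule DERIV_imp_deriv)
    next
      fix r u
      have s: "\<omega> s c x (v(i := r *\<^sub>R u)) = r * \<omega> s c x (v(i := u))" for s
        using linear_scale[OF alternating_linear[OF alt i]] by simp
      have "((\<lambda>s. r * \<omega> s c x (v(i := u))) has_real_derivative
          r * form_dot \<omega> t c x (v(i := u))) (at t)"
        by (rule DERIV_cmult[OF D])
      then show "form_dot \<omega> t c x (v(i := r *\<^sub>R u)) = r *\<^sub>R form_dot \<omega> t c x (v(i := u))"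
        unfolding form_dot_def[of \<omega> t] s real_scaleR_def by (rule DERIV_imp_deriv)
    qed
  next
    fix v :: "nat \<Rightarrow> 'e" and i j assume "i < k" "j < k" "i \<noteq> j \<and> v i = v j"
    then have "\<omega> s c x v = 0" for s using alternating_eq_0[OF alt[of s]] by metis
    then show "form_dot \<omega> t c x v = 0" by (simp add: form_dot_def)
  qed
next
  fix t c d x v assume cd: "c \<in> A" "d \<in> A" "x \<in> overlap c d"
  show "form_dot \<omega> t c x v =
    form_dot \<omega> t d (transition c d x) (\<lambda>i. dir_deriv (transition c d) x (v i))"
    unfolding form_dot_def k_form_natural[OF family_k_form[OF \<omega>] cd] ..
qed

lemma ext_deriv_joint_smooth:
  assumes \<omega>: "smooth_form_family A k \<omega>" and c: "c \<in> A"
  shows "smooth_on (UNIV \<times> codom c) (\<lambda>p. ext_deriv k (\<omega> (fst p)) c (snd p) v)"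
proof -
  let ?w = "\<lambda>i j. if j < i then v j else v (Suc j)"
  have "smooth_on (UNIV \<times> codom c) (\<lambda>p. \<Sum>i\<le>k. (- 1) ^ i *
      dir_deriv (\<lambda>p. \<omega> (fst p) c (snd p) (?w i)) p (0, v i))"
    by (intro smooth_on_sum smooth_on_mult smooth_on_const smooth_on_dir_deriv
        family_joint_smooth[OF \<omega> c] open_cylinder[OF c])
  then show ?thesis
    by (rule smooth_on_cong[OF open_cylinder[OF c], THEN iffD2, rotated])
      (auto simp: ext_deriv_def dir_deriv_eq_joint[OF \<omega> c])
qed

text \<open>
  Both sides are mixed second derivatives of the jointly smooth coordinate expression, in the
  directions \<open>(1, 0)\<close> and \<open>(0, u)\<close> of parameter and point.
\<close>

lemma ext_deriv_form_dot:
  assumes \<omega>: "smooth_form_family A k \<omega>" and c: "c \<in> A" "x \<in> codom c"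
  shows "ext_deriv k (form_dot \<omega> t) c x v = form_dot (\<lambda>s. ext_deriv k (\<omega> s)) t c x v"
proof -
  let ?w = "\<lambda>i j. if j < i then v j else v (Suc j)"
  let ?J = "\<lambda>w p. \<omega> (fst p) c (snd p) w"
  have J: "smooth_on (UNIV \<times> codom c) (?J w)" for w by (rule family_joint_smooth[OF \<omega> c(1)])
  have sym: "dir_deriv (\<lambda>y. form_dot \<omega> t c y w) x u =
      dir_deriv (\<lambda>p. dir_deriv (?J w) p (0, u)) (t, x) (1, 0)" for w u
  proof -
    have "dir_deriv (\<lambda>y. form_dot \<omega> t c y w) x u = dir_deriv (\<lambda>y. dir_deriv (?J w) (t, y) (1, 0)) x u"
      by (subst frechet_derivative_cong_open[OF open_codom[OF c(1)] c(2),
            of _ "\<lambda>y. dir_deriv (?J w) (t, y) (1, 0)"]) (auto simp: form_dot_eq_dir_deriv[OF \<omega> c(1)])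
    also have "\<dots> = dir_deriv (\<lambda>p. dir_deriv (?J w) p (1, 0)) (t, x) (0, u)"
      by (rule dir_deriv_slice[OF smooth_on_dir_deriv[OF J] c(2)])
    also have "\<dots> = dir_deriv (\<lambda>p. dir_deriv (?J w) p (0, u)) (t, x) (1, 0)"
      using second_derivative_symmetric_real[OF J open_cylinder[OF c(1)]] c(2) by blast
    finally show ?thesis .
  qed
  have "((\<lambda>s. \<Sum>i\<le>k. (- 1) ^ i * dir_deriv (?J (?w i)) (s, x) (0, v i)) has_real_derivative
      (\<Sum>i\<le>k. (- 1) ^ i * dir_deriv (\<lambda>p. dir_deriv (?J (?w i)) p (0, v i)) (t, x) (1, 0))) (at t)"
    by (intro DERIV_sum DERIV_cmult DERIV_time_slice[OF smooth_on_dir_deriv[OF J] c(2)])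
  then have "form_dot (\<lambda>s. ext_deriv k (\<omega> s)) t c x v =
      (\<Sum>i\<le>k. (- 1) ^ i * dir_deriv (\<lambda>p. dir_deriv (?J (?w i)) p (0, v i)) (t, x) (1, 0))"
    by (simp add: form_dot_def ext_deriv_def dir_deriv_eq_joint[OF \<omega> c] DERIV_imp_deriv)
  then show ?thesis by (simp add: ext_deriv_def sym)
qed

end

section \<open>Wedge products as sums over shuffles\<close>

text \<open>
  A pair of vectors as the argument of a 2-form, which reads its argument only at \<open>0\<close> and \<open>1\<close>.
\<close>

abbreviation pair :: "'b \<Rightarrow> 'b \<Rightarrow> nat \<Rightarrow> 'b" where
  "pair u v \<equiv> (\<lambda>i. if i = 0 then u else v)"

lemma sum_permutations_2:
  fixes f :: "(nat \<Rightarrow> nat) \<Rightarrow> real"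
  shows "(\<Sum>\<sigma> | \<sigma> permutes {..<2::nat}. f \<sigma>) = f id + f (Transposition.transpose 0 1)"
proof -
  have "{..<2::nat} = insert 0 (insert 1 {})" by auto
  then show ?thesis
    by (simp add: sum_over_permutations_insert permutes_empty del: One_nat_def)
qed

text \<open>
  In this formula and in the following ones, \<open>p\<close>, \<open>q\<close> and \<open>r\<close> are the forms at one point as ordinary
  functions of vectors. Since 2-forms are skew, the permutations that differ only within one of the two
  blocks of arguments contribute equally; their number cancels the denominator.
\<close>

lemma wedge_1_1_eq:
  assumes "\<And>w. \<omega> c x w = p (w 0)" "\<And>w. \<eta> c x w = q (w 0)"
  shows "wedge 1 1 \<omega> \<eta> c x v = p (v 0) * q (v 1) - p (v 1) * q (v 0)"
  unfolding wedge_def assms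
  by (simp add: sum_permutations_2 sign_swap_id flip: numeral_2_eq_2)

lemma wedge_1_2_eq:
  assumes "\<And>w. \<omega> c x w = p (w 0)" "\<And>w. \<eta> c x w = q (w 0) (w 1)" "\<And>a b. q a b = - q b a"
  shows "wedge 1 2 \<omega> \<eta> c x v =
    p (v 0) * q (v 1) (v 2) - p (v 1) * q (v 0) (v 2) + p (v 2) * q (v 0) (v 1)"
proof -
  have S: "{..<1 + 2::nat} = insert 0 (insert 1 (insert 2 {}))" by auto
  have q: "q (v 1) (v 0) = - q (v 0) (v 1)" "q (v 2) (v 0) = - q (v 0) (v 2)"
    "q (v 2) (v 1) = - q (v 1) (v 2)" by (rule assms(3))+
  show ?thesis
    unfolding wedge_def assms(1,2) S
    by (simp add: sum_over_permutations_insert permutes_empty q sign_compose permutation_compose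
        permutation_swap_id sign_swap_id Transposition.transpose_def fact_numeral
        del: One_nat_def)
qed

lemma wedge_2_2_eq:
  assumes "\<And>w. \<omega> c x w = p (w 0) (w 1)" "\<And>w. \<eta> c x w = q (w 0) (w 1)"
    and "\<And>a b. p a b = - p b a" "\<And>a b. q a b = - q b a"
  shows "wedge 2 2 \<omega> \<eta> c x v =
    p (v 0) (v 1) * q (v 2) (v 3) - p (v 0) (v 2) * q (v 1) (v 3) + p (v 0) (v 3) * q (v 1) (v 2) +
    p (v 1) (v 2) * q (v 0) (v 3) - p (v 1) (v 3) * q (v 0) (v 2) + p (v 2) (v 3) * q (v 0) (v 1)"
proof -
  have S: "{..<2 + 2::nat} = insert 0 (insert 1 (insert 2 (insert 3 {})))" by auto
  have p: "p (v 1) (v 0) = - p (v 0) (v 1)" "p (v 2) (v 0) = - p (v 0) (v 2)"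
    "p (v 3) (v 0) = - p (v 0) (v 3)" "p (v 2) (v 1) = - p (v 1) (v 2)"
    "p (v 3) (v 1) = - p (v 1) (v 3)" "p (v 3) (v 2) = - p (v 2) (v 3)" by (rule assms(3))+
  have q: "q (v 1) (v 0) = - q (v 0) (v 1)" "q (v 2) (v 0) = - q (v 0) (v 2)"
    "q (v 3) (v 0) = - q (v 0) (v 3)" "q (v 2) (v 1) = - q (v 1) (v 2)"
    "q (v 3) (v 1) = - q (v 1) (v 3)" "q (v 3) (v 2) = - q (v 2) (v 3)" by (rule assms(4))+
  show ?thesis
    unfolding wedge_def assms(1,2) S
    by (simp add: sum_over_permutations_insert permutes_empty p q sign_compose permutation_compose
        permutation_swap_id sign_swap_id Transposition.transpose_def fact_numeral
        del: One_nat_def)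
qed

lemma wedge_cong:
  assumes "\<And>w. \<omega> c x w = \<omega>' c x w" "\<And>w. \<eta> c x w = \<eta>' c x w"
  shows "wedge k l \<omega> \<eta> c x v = wedge k l \<omega>' \<eta>' c x v"
  by (simp add: wedge_def assms)

lemma wedge_1_1_2_eq:
  assumes "\<And>w. \<omega> c x w = p (w 0)" "\<And>w. \<eta> c x w = q (w 0)"
    and "\<And>w. \<zeta> c x w = r (w 0) (w 1)" "\<And>a b. r a b = - r b a"
  shows "wedge 2 2 (wedge 1 1 \<omega> \<eta>) \<zeta> c x v =
    (p (v 0) * q (v 1) - p (v 1) * q (v 0)) * r (v 2) (v 3) -
    (p (v 0) * q (v 2) - p (v 2) * q (v 0)) * r (v 1) (v 3) +
    (p (v 0) * q (v 3) - p (v 3) * q (v 0)) * r (v 1) (v 2) +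
    (p (v 1) * q (v 2) - p (v 2) * q (v 1)) * r (v 0) (v 3) -
    (p (v 1) * q (v 3) - p (v 3) * q (v 1)) * r (v 0) (v 2) +
    (p (v 2) * q (v 3) - p (v 3) * q (v 2)) * r (v 0) (v 1)"
  by (rule wedge_2_2_eq[of "wedge 1 1 \<omega> \<eta>" c x "\<lambda>a b. p a * q b - p b * q a" \<zeta> r,
        OF wedge_1_1_eq[of \<omega> c x p \<eta> q, OF assms(1,2)] assms(3) _ assms(4)]) simp

section \<open>The exterior derivative in low degree\<close>

lemma sum_atMost_numerals:
  fixes f :: "nat \<Rightarrow> real"
  shows "(\<Sum>i\<le>1. f i) = f 0 + f 1"
    and "(\<Sum>i\<le>3. f i) = f 0 + f 1 + f 2 + f 3"
    and "(\<Sum>i\<le>4. f i) = f 0 + f 1 + f 2 + f 3 + f 4"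
  by (simp_all add: eval_nat_numeral)

lemma form_dot_cong:
  assumes "\<And>s. \<omega> s c x v = \<eta> s c x v"
  shows "form_dot \<omega> t c x v = form_dot \<eta> t c x v"
  by (simp add: form_dot_def assms)

context smooth_atlas
begin

lemma form_dot_wedge:
  assumes \<omega>: "smooth_form_family A k \<omega>" and \<eta>: "smooth_form_family A l \<eta>"
    and c: "c \<in> A" "x \<in> codom c"
  shows "form_dot (\<lambda>s. wedge k l (\<omega> s) (\<eta> s)) t c x v =
    wedge k l (form_dot \<omega> t) (\<eta> t) c x v + wedge k l (\<omega> t) (form_dot \<eta> t) c x v"
proof -
  let ?P = "{\<sigma>. \<sigma> permutes {..<k + l}}"
  let ?a = "\<lambda>\<sigma> i. v (\<sigma> i)" and ?b = "\<lambda>\<sigma> i. v (\<sigma> (k + i))"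
  have "((\<lambda>s. \<omega> s c x (?a \<sigma>) * \<eta> s c x (?b \<sigma>)) has_real_derivative
      form_dot \<omega> t c x (?a \<sigma>) * \<eta> t c x (?b \<sigma>) + form_dot \<eta> t c x (?b \<sigma>) * \<omega> t c x (?a \<sigma>)) (at t)" for \<sigma>
    by (rule DERIV_mult[OF family_DERIV[OF \<omega> c] family_DERIV[OF \<eta> c]])
  then have "((\<lambda>s. (\<Sum>\<sigma>\<in>?P. of_int (sign \<sigma>) * (\<omega> s c x (?a \<sigma>) * \<eta> s c x (?b \<sigma>))) / (fact k * fact l))
      has_real_derivative (\<Sum>\<sigma>\<in>?P. of_int (sign \<sigma>) * (form_dot \<omega> t c x (?a \<sigma>) * \<eta> t c x (?b \<sigma>)
        + form_dot \<eta> t c x (?b \<sigma>) * \<omega> t c x (?a \<sigma>))) / (fact k * fact l)) (at t)"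
    by (intro DERIV_cdivide DERIV_sum DERIV_cmult)
  moreover have "form_dot (\<lambda>s. wedge k l (\<omega> s) (\<eta> s)) t c x v =
      deriv (\<lambda>s. (\<Sum>\<sigma>\<in>?P. of_int (sign \<sigma>) * (\<omega> s c x (?a \<sigma>) * \<eta> s c x (?b \<sigma>))) / (fact k * fact l)) t"
    by (simp only: form_dot_def wedge_def mult.assoc)
  ultimately have "form_dot (\<lambda>s. wedge k l (\<omega> s) (\<eta> s)) t c x v =
      (\<Sum>\<sigma>\<in>?P. of_int (sign \<sigma>) * (form_dot \<omega> t c x (?a \<sigma>) * \<eta> t c x (?b \<sigma>)
        + form_dot \<eta> t c x (?b \<sigma>) * \<omega> t c x (?a \<sigma>))) / (fact k * fact l)"
    by (simp only: DERIV_imp_deriv)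
  then show ?thesis
    by (simp add: wedge_def ring_distribs sum.distrib add_divide_distrib mult_ac)
qed

lemma one_form_eval:
  "k_form A 1 \<omega> \<Longrightarrow> c \<in> A \<Longrightarrow> x \<in> codom c \<Longrightarrow> \<omega> c x w = \<omega> c x (\<lambda>_. w 0)"
  by (rule alternating_cong[OF k_form_alternating]) auto

lemma one_form_linear:
  assumes "k_form A 1 \<omega>" "c \<in> A" "x \<in> codom c"
  shows "linear (\<lambda>u. \<omega> c x (\<lambda>_. u))"
proof -
  have "linear (\<lambda>u. \<omega> c x ((\<lambda>_. 0)(0 := u)))"
    by (rule alternating_linear[OF k_form_alternating[OF assms]]) simp
  then show ?thesis
    by (simp add: one_form_eval[OF assms, of "(\<lambda>_. 0)(0 := _)"])
qed

lemma ext_deriv_1_eq: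
  assumes "k_form A 1 \<omega>" "c \<in> A" "x \<in> codom c"
  shows "ext_deriv 1 \<omega> c x v =
    dir_deriv (\<lambda>y. \<omega> c y (\<lambda>_. v 1)) x (v 0) - dir_deriv (\<lambda>y. \<omega> c y (\<lambda>_. v 0)) x (v 1)"
proof -
  have "dir_deriv (\<lambda>y. \<omega> c y w) x = dir_deriv (\<lambda>y. \<omega> c y (\<lambda>_. w 0)) x" for w
    by (rule frechet_derivative_cong_open[OF open_codom[OF assms(2)] assms(3)])
      (rule one_form_eval[OF assms(1,2)])
  from this[of "\<lambda>j. if j < 0 then v j else v (Suc j)"]
    this[of "\<lambda>j. if j < 1 then v j else v (Suc j)"]
  show ?thesis
    unfolding ext_deriv_def sum_atMost_numerals by simp
qed

lemma ext_deriv_1_pair: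
  assumes "k_form A 1 \<omega>" "c \<in> A" "x \<in> codom c"
  shows "ext_deriv 1 \<omega> c x v = ext_deriv 1 \<omega> c x (pair (v 0) (v 1))"
    and "ext_deriv 1 \<omega> c x (pair a b) = - ext_deriv 1 \<omega> c x (pair b a)"
  by (simp_all add: ext_deriv_1_eq[OF assms] del: One_nat_def)

lemma ext_deriv_0_func_form: "ext_deriv 0 (func_form h) c x v = dir_deriv (h c) x (v 0)"
  by (simp add: ext_deriv_def func_form_def)

lemma family_ext_deriv_0:
  assumes h: "smooth_form_family A 0 (\<lambda>t. func_form (h t))"
  shows "smooth_form_family A 1 (\<lambda>t. ext_deriv 0 (func_form (h t)))"
proof (rule smooth_form_familyI)
  fix c v assume "c \<in> A"
  then show "smooth_on (UNIV \<times> codom c) (\<lambda>p. ext_deriv 0 (func_form (h (fst p))) c (snd p) v)"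
    by (rule ext_deriv_joint_smooth[OF h])
next
  fix t c x assume c: "c \<in> A" "x \<in> codom c"
  have "(h t c has_derivative dir_deriv (h t c) x) (at x)"
    using k_form_has_derivative[OF family_k_form[OF h] c] by (simp add: func_form_def)
  then show "alternating_multilinear 1 (ext_deriv 0 (func_form (h t)) c x)"
    using has_derivative_linear by (auto simp: alternating_multilinear_def ext_deriv_0_func_form)
next
  fix t c d x v assume cd: "c \<in> A" "d \<in> A" "x \<in> overlap c d"
  let ?\<phi> = "transition c d"
  have "dir_deriv (h t c) x u = dir_deriv (h t d) (?\<phi> x) (dir_deriv ?\<phi> x u)" for u
  proof -
    have "dir_deriv (h t c) x u = dir_deriv (\<lambda>y. h t d (?\<phi> y)) x u"
      using k_form_natural[OF family_k_form[OF h] cd(1,2)]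
      by (subst frechet_derivative_cong_open[OF open_overlap[OF cd(1,2)] cd(3),
            of _ "\<lambda>y. h t d (?\<phi> y)"]) (auto simp: func_form_def)
    also have "\<dots> = dir_deriv (h t d) (?\<phi> x) (dir_deriv ?\<phi> x u)"
    proof (rule dir_derivI)
      have "(h t d has_derivative dir_deriv (h t d) (?\<phi> x)) (at (?\<phi> x))"
        using k_form_has_derivative[OF family_k_form[OF h] cd(2) transition_in_codom[OF cd(1,3)]]
        by (simp add: func_form_def)
      with smooth_on_imp_has_derivative[OF smooth_transition[OF cd(1,2)] cd(3)]
      show "((\<lambda>y. h t d (?\<phi> y)) has_derivative
          (\<lambda>u. dir_deriv (h t d) (?\<phi> x) (dir_deriv ?\<phi> x u))) (at x)"
        by (rule has_derivative_compose)
    qed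
    finally show ?thesis .
  qed
  then show "ext_deriv 0 (func_form (h t)) c x v =
    ext_deriv 0 (func_form (h t)) d (?\<phi> x) (\<lambda>i. dir_deriv ?\<phi> x (v i))"
    by (simp add: ext_deriv_0_func_form)
qed

lemma dir_deriv_one_form_linear:
  assumes "k_form A 1 \<omega>" "c \<in> A" "x \<in> codom c"
  shows "linear (\<lambda>w. dir_deriv (\<lambda>y. \<omega> c y (\<lambda>_. w)) x u)"
proof (rule linearI)
  note D = k_form_has_derivative[OF assms]
  note cong = frechet_derivative_cong_open[OF open_codom[OF assms(2)] assms(3)]
  fix w w'
  have "dir_deriv (\<lambda>y. \<omega> c y (\<lambda>_. w + w')) x u =
      dir_deriv (\<lambda>y. \<omega> c y (\<lambda>_. w) + \<omega> c y (\<lambda>_. w')) x u"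
    by (subst cong[of _ "\<lambda>y. \<omega> c y (\<lambda>_. w) + \<omega> c y (\<lambda>_. w')"])
      (auto simp: linear_add[OF one_form_linear[OF assms(1,2)]])
  also have "\<dots> = dir_deriv (\<lambda>y. \<omega> c y (\<lambda>_. w)) x u + dir_deriv (\<lambda>y. \<omega> c y (\<lambda>_. w')) x u"
    by (rule dir_derivI[OF has_derivative_add[OF D D]])
  finally show "dir_deriv (\<lambda>y. \<omega> c y (\<lambda>_. w + w')) x u =
    dir_deriv (\<lambda>y. \<omega> c y (\<lambda>_. w)) x u + dir_deriv (\<lambda>y. \<omega> c y (\<lambda>_. w')) x u" .
next
  note D = k_form_has_derivative[OF assms]
  note cong = frechet_derivative_cong_open[OF open_codom[OF assms(2)] assms(3)]
  fix r w
  have "dir_deriv (\<lambda>y. \<omega> c y (\<lambda>_. r *\<^sub>R w)) x u = dir_deriv (\<lambda>y. r *\<^sub>R \<omega> c y (\<lambda>_. w)) x u"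
    by (subst cong[of _ "\<lambda>y. r *\<^sub>R \<omega> c y (\<lambda>_. w)"])
      (auto simp: linear_scale[OF one_form_linear[OF assms(1,2)]])
  also have "\<dots> = r *\<^sub>R dir_deriv (\<lambda>y. \<omega> c y (\<lambda>_. w)) x u"
    by (rule dir_derivI[OF has_derivative_scaleR_right[OF D]])
  finally show "dir_deriv (\<lambda>y. \<omega> c y (\<lambda>_. r *\<^sub>R w)) x u = r *\<^sub>R dir_deriv (\<lambda>y. \<omega> c y (\<lambda>_. w)) x u" .
qed

lemma linear_expand_basis:
  fixes f :: "'e \<Rightarrow> real"
  assumes "linear f"
  shows "f u = (\<Sum>b\<in>Basis. (u \<bullet> b) * f b)"
proof -
  have "f u = f (\<Sum>b\<in>Basis. (u \<bullet> b) *\<^sub>R b)" by (simp add: euclidean_representation)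
  also have "\<dots> = (\<Sum>b\<in>Basis. (u \<bullet> b) * f b)"
    by (simp add: linear_sum[OF assms] linear_scale[OF assms])
  finally show ?thesis .
qed

text \<open>
  Differentiate \<open>\<omega>\<^sub>c(y)(u) = \<omega>\<^sub>d(\<phi> y)(D\<phi>\<^sub>y u)\<close>, where the right-hand side is expanded in the standard
  basis so that the product rule applies. The first sum is symmetric in \<open>u\<close> and \<open>v\<close>, so it drops out
  of the exterior derivative; the second summand is the one that naturality of \<open>d\<close> asks for.
\<close>

lemma dir_deriv_one_form_transition:
  assumes \<omega>: "k_form A 1 \<omega>" and cd: "c \<in> A" "d \<in> A" "x \<in> overlap c d"
  shows "dir_deriv (\<lambda>y. \<omega> c y (\<lambda>_. u)) x v =
    (\<Sum>b\<in>Basis. (dir_deriv (\<lambda>y. dir_deriv (transition c d) y u) x v \<bullet> b) *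
       \<omega> d (transition c d x) (\<lambda>_. b)) +
    dir_deriv (\<lambda>z. \<omega> d z (\<lambda>_. dir_deriv (transition c d) x u)) (transition c d x)
      (dir_deriv (transition c d) x v)"
proof -
  let ?\<phi> = "transition c d"
  note in_codom = transition_in_codom[OF cd(1)]
  note D\<phi> = smooth_on_imp_has_derivative[OF smooth_transition[OF cd(1,2)] cd(3)]
  note DD\<phi> = smooth_on_imp_has_derivative[OF smooth_on_dir_deriv[OF smooth_transition[OF cd(1,2)]] cd(3)]
  have expand: "\<omega> c y (\<lambda>_. u) = (\<Sum>b\<in>Basis. (dir_deriv ?\<phi> y u \<bullet> b) * \<omega> d (?\<phi> y) (\<lambda>_. b))"
    if "y \<in> overlap c d" for y
    unfolding k_form_natural[OF \<omega> cd(1,2) that]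
    by (rule linear_expand_basis[OF one_form_linear[OF \<omega> cd(2) in_codom[OF that]]])
  have "((\<lambda>y. \<Sum>b\<in>Basis. (dir_deriv ?\<phi> y u \<bullet> b) * \<omega> d (?\<phi> y) (\<lambda>_. b)) has_derivative
     (\<lambda>v. \<Sum>b\<in>Basis. (dir_deriv ?\<phi> x u \<bullet> b) *
         dir_deriv (\<lambda>z. \<omega> d z (\<lambda>_. b)) (?\<phi> x) (dir_deriv ?\<phi> x v) +
       (dir_deriv (\<lambda>y. dir_deriv ?\<phi> y u) x v \<bullet> b) * \<omega> d (?\<phi> x) (\<lambda>_. b))) (at x)"
    by (intro has_derivative_sum has_derivative_mult has_derivative_inner_left DD\<phi>
        has_derivative_compose[OF D\<phi>] k_form_has_derivative[OF \<omega> cd(2) in_codom[OF cd(3)]])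
  then have "dir_deriv (\<lambda>y. \<omega> c y (\<lambda>_. u)) x v =
    (\<Sum>b\<in>Basis. (dir_deriv ?\<phi> x u \<bullet> b) *
         dir_deriv (\<lambda>z. \<omega> d z (\<lambda>_. b)) (?\<phi> x) (dir_deriv ?\<phi> x v) +
       (dir_deriv (\<lambda>y. dir_deriv ?\<phi> y u) x v \<bullet> b) * \<omega> d (?\<phi> x) (\<lambda>_. b))"
    by (subst frechet_derivative_cong_open[OF open_overlap[OF cd(1,2)] cd(3) expand])
      (auto intro: dir_derivI)
  also have "\<dots> = (\<Sum>b\<in>Basis. (dir_deriv (\<lambda>y. dir_deriv ?\<phi> y u) x v \<bullet> b) * \<omega> d (?\<phi> x) (\<lambda>_. b)) +
      (\<Sum>b\<in>Basis. (dir_deriv ?\<phi> x u \<bullet> b) *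
         dir_deriv (\<lambda>z. \<omega> d z (\<lambda>_. b)) (?\<phi> x) (dir_deriv ?\<phi> x v))"
    by (simp add: sum.distrib)
  finally show ?thesis
    using linear_expand_basis[OF dir_deriv_one_form_linear[OF \<omega> cd(2) in_codom[OF cd(3)]],
        of "dir_deriv ?\<phi> x u" "dir_deriv ?\<phi> x v"] by simp
qed

lemma family_ext_deriv_1:
  assumes \<omega>: "smooth_form_family A 1 \<omega>"
  shows "smooth_form_family A 2 (\<lambda>t. ext_deriv 1 (\<omega> t))"
proof (rule smooth_form_familyI)
  fix c v assume "c \<in> A"
  then show "smooth_on (UNIV \<times> codom c) (\<lambda>p. ext_deriv 1 (\<omega> (fst p)) c (snd p) v)"
    by (rule ext_deriv_joint_smooth[OF \<omega>])
next
  fix t c x assume c: "c \<in> A" "x \<in> codom c"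
  note k = family_k_form[OF \<omega>, of t]
  note E = ext_deriv_1_eq[OF k c]
  note l1 = dir_deriv_one_form_linear[OF k c]
  note l2 = has_derivative_linear[OF k_form_has_derivative[OF k c]]
  show "alternating_multilinear 2 (ext_deriv 1 (\<omega> t) c x)"
    unfolding alternating_multilinear_def
  proof (intro conjI allI impI)
    fix v w :: "nat \<Rightarrow> 'e" assume "\<forall>i<2. v i = w i"
    then show "ext_deriv 1 (\<omega> t) c x v = ext_deriv 1 (\<omega> t) c x w" by (simp add: E del: One_nat_def)
  next
    fix i :: nat and v :: "nat \<Rightarrow> 'e" assume "i < 2"
    then consider "i = 0" | "i = 1" by linarith
    then show "linear (\<lambda>u. ext_deriv 1 (\<omega> t) c x (v(i := u)))"
      by cases (simp_all add: E linear_compose_sub l1 l2 del: One_nat_def)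
  next
    fix v :: "nat \<Rightarrow> 'e" and i j :: nat assume "i < 2" "j < 2" "i \<noteq> j \<and> v i = v j"
    then have "v 0 = v 1" by (auto simp: less_2_cases_iff)
    then show "ext_deriv 1 (\<omega> t) c x v = 0" by (simp add: E del: One_nat_def)
  qed
next
  fix t c d x v assume cd: "c \<in> A" "d \<in> A" "x \<in> overlap c d"
  have x: "x \<in> codom c" by (rule subsetD[OF overlap_subset_codom cd(3)])
  note k = family_k_form[OF \<omega>, of t]
  show "ext_deriv 1 (\<omega> t) c x v =
    ext_deriv 1 (\<omega> t) d (transition c d x) (\<lambda>i. dir_deriv (transition c d) x (v i))"
    unfolding ext_deriv_1_eq[OF k cd(1) x]
      ext_deriv_1_eq[OF k cd(2) transition_in_codom[OF cd(1,3)]]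
      dir_deriv_one_form_transition[OF k cd]
      second_derivative_symmetric[OF smooth_transition[OF cd(1,2)] open_overlap[OF cd(1,2)] cd(3),
        of "v 1" "v 0"]
    by simp
qed

section \<open>Leibniz rules\<close>

lemma ext_deriv_1_pair_has_derivative:
  assumes "k_form A 1 \<mu>" "c \<in> A" "x \<in> codom c"
  shows "((\<lambda>y. ext_deriv 1 \<mu> c y (pair a b)) has_derivative
    dir_deriv (\<lambda>y. ext_deriv 1 \<mu> c y (pair a b)) x) (at x)"
    and "dir_deriv (\<lambda>y. ext_deriv 1 \<mu> c y (pair a b)) x u =
      dir_deriv (\<lambda>y. dir_deriv (\<lambda>y. \<mu> c y (\<lambda>_. b)) y a) x u -
      dir_deriv (\<lambda>y. dir_deriv (\<lambda>y. \<mu> c y (\<lambda>_. a)) y b) x u"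
proof -
  have D: "((\<lambda>y. dir_deriv (\<lambda>y. \<mu> c y (\<lambda>_. b)) y a - dir_deriv (\<lambda>y. \<mu> c y (\<lambda>_. a)) y b)
    has_derivative (\<lambda>u. dir_deriv (\<lambda>y. dir_deriv (\<lambda>y. \<mu> c y (\<lambda>_. b)) y a) x u -
      dir_deriv (\<lambda>y. dir_deriv (\<lambda>y. \<mu> c y (\<lambda>_. a)) y b) x u)) (at x)"
    by (intro has_derivative_diff smooth_on_imp_has_derivative[OF _ assms(3)] smooth_on_dir_deriv
        k_form_smooth[OF assms(1,2)])
  have "((\<lambda>y. ext_deriv 1 \<mu> c y (pair a b)) has_derivative
    (\<lambda>u. dir_deriv (\<lambda>y. dir_deriv (\<lambda>y. \<mu> c y (\<lambda>_. b)) y a) x u -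
      dir_deriv (\<lambda>y. dir_deriv (\<lambda>y. \<mu> c y (\<lambda>_. a)) y b) x u)) (at x)"
    by (rule has_derivative_cong_open[OF open_codom[OF assms(2)] assms(3), THEN iffD2, OF _ D])
      (simp add: ext_deriv_1_eq[OF assms(1,2)] del: One_nat_def)
  note E = this
  show "dir_deriv (\<lambda>y. ext_deriv 1 \<mu> c y (pair a b)) x u =
      dir_deriv (\<lambda>y. dir_deriv (\<lambda>y. \<mu> c y (\<lambda>_. b)) y a) x u -
      dir_deriv (\<lambda>y. dir_deriv (\<lambda>y. \<mu> c y (\<lambda>_. a)) y b) x u"
    by (rule dir_derivI[OF E])
  show "((\<lambda>y. ext_deriv 1 \<mu> c y (pair a b)) has_derivative
    dir_deriv (\<lambda>y. ext_deriv 1 \<mu> c y (pair a b)) x) (at x)"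
    using E frechet_derivative_at[OF E] by simp
qed

text \<open>
  This is \<open>d d\<mu> = 0\<close>: the six second derivatives cancel in pairs.
\<close>

lemma ext_deriv_ext_deriv_1:
  assumes \<mu>: "k_form A 1 \<mu>" and c: "c \<in> A" "x \<in> codom c"
  shows "dir_deriv (\<lambda>y. ext_deriv 1 \<mu> c y (pair v w)) x u -
    dir_deriv (\<lambda>y. ext_deriv 1 \<mu> c y (pair u w)) x v +
    dir_deriv (\<lambda>y. ext_deriv 1 \<mu> c y (pair u v)) x w = 0"
  unfolding ext_deriv_1_pair_has_derivative(2)[OF assms]
    second_derivative_symmetric_real[OF k_form_smooth[OF \<mu> c(1)] open_codom[OF c(1)] c(2), of _ v u]
    second_derivative_symmetric_real[OF k_form_smooth[OF \<mu> c(1)] open_codom[OF c(1)] c(2), of _ w u]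
    second_derivative_symmetric_real[OF k_form_smooth[OF \<mu> c(1)] open_codom[OF c(1)] c(2), of _ w v]
  by simp

lemma ext_deriv_ext_deriv_0:
  assumes h: "smooth_form_family A 0 (\<lambda>t. func_form (h t))" and c: "c \<in> A" "x \<in> codom c"
  shows "ext_deriv 1 (ext_deriv 0 (func_form (h t))) c x v = 0"
proof -
  have "smooth_on (codom c) (h t c)"
    using k_form_smooth[OF family_k_form[OF h] c(1)] by (simp add: func_form_def)
  from second_derivative_symmetric_real[OF this open_codom[OF c(1)] c(2)]
  show ?thesis
    unfolding ext_deriv_1_eq[OF family_k_form[OF family_ext_deriv_0[OF h]] c] ext_deriv_0_func_form
    by simp
qed

text \<open>
  The Leibniz rule \<open>d (s \<kappa> \<and> d\<mu>) = ds \<and> \<kappa> \<and> d\<mu> + s d\<kappa> \<and> d\<mu>\<close>; every primitive below is a combination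
  of forms \<open>s \<kappa> \<and> d\<mu>\<close>.
\<close>

lemma ext_deriv_3_scaled_wedge:
  assumes s: "k_form A 0 (func_form s)" and \<kappa>: "k_form A 1 \<kappa>" and \<mu>: "k_form A 1 \<mu>"
    and c: "c \<in> A" "x \<in> codom c"
  shows "ext_deriv 3 (form_scale s (wedge 1 2 \<kappa> (ext_deriv 1 \<mu>))) c x v =
    wedge 2 2 (wedge 1 1 (ext_deriv 0 (func_form s)) \<kappa>) (ext_deriv 1 \<mu>) c x v +
    s c x * wedge 2 2 (ext_deriv 1 \<kappa>) (ext_deriv 1 \<mu>) c x v"
proof -
  define L where "L y u = \<kappa> c y (\<lambda>_. u)" for y u
  define N where "N y a b = ext_deriv 1 \<mu> c y (pair a b)" for y a b
  define L' where "L' a u = dir_deriv (\<lambda>y. L y a) x u" for a u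
  define N' where "N' a b u = dir_deriv (\<lambda>y. N y a b) x u" for a b u
  define s' where "s' u = dir_deriv (s c) x u" for u
  note defs = L_def N_def L'_def N'_def s'_def
  have Ds: "(s c has_derivative s') (at x)"
    using k_form_has_derivative[OF s c] by (simp add: func_form_def s'_def[abs_def])
  have DL: "((\<lambda>y. L y a) has_derivative L' a) (at x)" for a
    using k_form_has_derivative[OF \<kappa> c] by (simp add: defs[abs_def])
  have DN: "((\<lambda>y. N y a b) has_derivative N' a b) (at x)" for a b
    using ext_deriv_1_pair_has_derivative(1)[OF \<mu> c] by (simp add: defs[abs_def])
  have lam: "\<kappa> c y w = L y (w 0)" if "y \<in> codom c" for y w
    unfolding L_def by (rule one_form_eval[OF \<kappa> c(1) that])
  have dmu: "ext_deriv 1 \<mu> c y w = N y (w 0) (w 1)" if "y \<in> codom c" for y w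
    unfolding N_def by (rule ext_deriv_1_pair(1)[OF \<mu> c(1) that])
  have N_anti: "N y a b = - N y b a" if "y \<in> codom c" for y a b
    unfolding N_def by (rule ext_deriv_1_pair(2)[OF \<mu> c(1) that])
  have theta: "form_scale s (wedge 1 2 \<kappa> (ext_deriv 1 \<mu>)) c y w = s c y *
      (L y (w 0) * N y (w 1) (w 2) - L y (w 1) * N y (w 0) (w 2) + L y (w 2) * N y (w 0) (w 1))"
    if "y \<in> codom c" for y w
    unfolding form_scale_def wedge_1_2_eq[of \<kappa> c y "L y" "ext_deriv 1 \<mu>" "N y", OF lam[OF that] dmu[OF that] N_anti[OF that]] ..
  have D: "dir_deriv (\<lambda>y. form_scale s (wedge 1 2 \<kappa> (ext_deriv 1 \<mu>)) c y w) x u =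
      s c x * (L x (w 0) * N' (w 1) (w 2) u + L' (w 0) u * N x (w 1) (w 2)
        - (L x (w 1) * N' (w 0) (w 2) u + L' (w 1) u * N x (w 0) (w 2))
        + (L x (w 2) * N' (w 0) (w 1) u + L' (w 2) u * N x (w 0) (w 1)))
      + s' u * (L x (w 0) * N x (w 1) (w 2) - L x (w 1) * N x (w 0) (w 2) + L x (w 2) * N x (w 0) (w 1))"
    for w u
    by (rule dir_derivI, rule has_derivative_cong_open[OF open_codom[OF c(1)] c(2), THEN iffD2],
        erule theta, intro has_derivative_mult has_derivative_add has_derivative_diff Ds DL DN)
  have ds: "ext_deriv 0 (func_form s) c x w = s' (w 0)" for w
    by (simp add: ext_deriv_0_func_form s'_def)
  have dlam: "ext_deriv 1 \<kappa> c x w = L' (w 1) (w 0) - L' (w 0) (w 1)" for w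
    unfolding defs by (rule ext_deriv_1_eq[OF \<kappa> c])
  \<comment> \<open>\<open>d d\<close> of the last factor, which occurs below as a coefficient\<close>
  have coc: "N' b d a - N' a d b + N' a b d = 0" for a b d
    unfolding defs by (rule ext_deriv_ext_deriv_1[OF \<mu> c])
  have wedge_ds: "wedge 2 2 (wedge 1 1 (ext_deriv 0 (func_form s)) \<kappa>) (ext_deriv 1 \<mu>) c x v =
      (s' (v 0) * L x (v 1) - s' (v 1) * L x (v 0)) * N x (v 2) (v 3)
      - (s' (v 0) * L x (v 2) - s' (v 2) * L x (v 0)) * N x (v 1) (v 3)
      + (s' (v 0) * L x (v 3) - s' (v 3) * L x (v 0)) * N x (v 1) (v 2)
      + (s' (v 1) * L x (v 2) - s' (v 2) * L x (v 1)) * N x (v 0) (v 3)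
      - (s' (v 1) * L x (v 3) - s' (v 3) * L x (v 1)) * N x (v 0) (v 2)
      + (s' (v 2) * L x (v 3) - s' (v 3) * L x (v 2)) * N x (v 0) (v 1)"
    by (rule wedge_2_2_eq[of "wedge 1 1 (ext_deriv 0 (func_form s)) \<kappa>" c x "\<lambda>a b. s' a * L x b - s' b * L x a" "ext_deriv 1 \<mu>" "N x",
          OF wedge_1_1_eq[of "ext_deriv 0 (func_form s)" c x s' \<kappa> "L x", OF ds lam[OF c(2)]]
            dmu[OF c(2)] _ N_anti[OF c(2)]]) simp
  have wedge_dlam: "wedge 2 2 (ext_deriv 1 \<kappa>) (ext_deriv 1 \<mu>) c x v =
      (L' (v 1) (v 0) - L' (v 0) (v 1)) * N x (v 2) (v 3)
      - (L' (v 2) (v 0) - L' (v 0) (v 2)) * N x (v 1) (v 3)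
      + (L' (v 3) (v 0) - L' (v 0) (v 3)) * N x (v 1) (v 2)
      + (L' (v 2) (v 1) - L' (v 1) (v 2)) * N x (v 0) (v 3)
      - (L' (v 3) (v 1) - L' (v 1) (v 3)) * N x (v 0) (v 2)
      + (L' (v 3) (v 2) - L' (v 2) (v 3)) * N x (v 0) (v 1)"
    by (rule wedge_2_2_eq[of "ext_deriv 1 \<kappa>" c x "\<lambda>a b. L' b a - L' a b" "ext_deriv 1 \<mu>" "N x",
          OF dlam dmu[OF c(2)] _ N_anti[OF c(2)]]) simp
  have e: "Suc 0 = 1" "Suc 1 = 2" "Suc 2 = 3" by simp_all
  have "ext_deriv 3 (form_scale s (wedge 1 2 \<kappa> (ext_deriv 1 \<mu>))) c x v =
    wedge 2 2 (wedge 1 1 (ext_deriv 0 (func_form s)) \<kappa>) (ext_deriv 1 \<mu>) c x v +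
    s c x * wedge 2 2 (ext_deriv 1 \<kappa>) (ext_deriv 1 \<mu>) c x v
    - s c x * (L x (v 0) * (N' (v 2) (v 3) (v 1) - N' (v 1) (v 3) (v 2) + N' (v 1) (v 2) (v 3))
      - L x (v 1) * (N' (v 2) (v 3) (v 0) - N' (v 0) (v 3) (v 2) + N' (v 0) (v 2) (v 3))
      + L x (v 2) * (N' (v 1) (v 3) (v 0) - N' (v 0) (v 3) (v 1) + N' (v 0) (v 1) (v 3))
      - L x (v 3) * (N' (v 1) (v 2) (v 0) - N' (v 0) (v 2) (v 1) + N' (v 0) (v 1) (v 2)))"
    unfolding wedge_ds wedge_dlam
    unfolding ext_deriv_def[of 3] sum_atMost_numerals D
    by (simp add: e algebra_simps del: One_nat_def)
  then show ?thesis by (simp add: coc)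
qed

text \<open>
  By the Leibniz rule \<open>d (\<kappa> \<and> \<mu> \<and> d\<nu>) = d\<kappa> \<and> \<mu> \<and> d\<nu> - \<kappa> \<and> d\<mu> \<and> d\<nu>\<close>, whose two terms contain the
  vanishing products as factors.
\<close>

lemma ext_deriv_4_wedge:
  assumes \<kappa>: "k_form A 1 \<kappa>" and \<mu>: "k_form A 1 \<mu>" and \<nu>: "k_form A 1 \<nu>"
    and c: "c \<in> A" "x \<in> codom c"
    and 1: "\<And>v. wedge 2 2 (ext_deriv 1 \<kappa>) (ext_deriv 1 \<nu>) c x v = 0"
    and 2: "\<And>v. wedge 2 2 (ext_deriv 1 \<mu>) (ext_deriv 1 \<nu>) c x v = 0"
  shows "ext_deriv 4 (wedge 2 2 (wedge 1 1 \<kappa> \<mu>) (ext_deriv 1 \<nu>)) c x v = 0"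
proof -
  define L where "L y u = \<kappa> c y (\<lambda>_. u)" for y u
  define K where "K y u = \<mu> c y (\<lambda>_. u)" for y u
  define N where "N y a b = ext_deriv 1 \<nu> c y (pair a b)" for y a b
  define L' where "L' a u = dir_deriv (\<lambda>y. L y a) x u" for a u
  define K' where "K' a u = dir_deriv (\<lambda>y. K y a) x u" for a u
  define N' where "N' a b u = dir_deriv (\<lambda>y. N y a b) x u" for a b u
  note defs = L_def K_def N_def L'_def K'_def N'_def
  have DL: "((\<lambda>y. L y a) has_derivative L' a) (at x)" for a
    using k_form_has_derivative[OF \<kappa> c] by (simp add: defs[abs_def])
  have DK: "((\<lambda>y. K y a) has_derivative K' a) (at x)" for a
    using k_form_has_derivative[OF \<mu> c] by (simp add: defs[abs_def])
  have DN: "((\<lambda>y. N y a b) has_derivative N' a b) (at x)" for a b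
    using ext_deriv_1_pair_has_derivative(1)[OF \<nu> c] by (simp add: defs[abs_def])
  have lam: "\<kappa> c y w = L y (w 0)" if "y \<in> codom c" for y w
    unfolding L_def by (rule one_form_eval[OF \<kappa> c(1) that])
  have mu: "\<mu> c y w = K y (w 0)" if "y \<in> codom c" for y w
    unfolding K_def by (rule one_form_eval[OF \<mu> c(1) that])
  have dnu: "ext_deriv 1 \<nu> c y w = N y (w 0) (w 1)" if "y \<in> codom c" for y w
    unfolding N_def by (rule ext_deriv_1_pair(1)[OF \<nu> c(1) that])
  have N_anti: "N y a b = - N y b a" if "y \<in> codom c" for y a b
    unfolding N_def by (rule ext_deriv_1_pair(2)[OF \<nu> c(1) that])
  define P where "P y a b = L y a * K y b - L y b * K y a" for y a b
  define P' where "P' a b u = (L x a * K' b u + L' a u * K x b) - (L x b * K' a u + L' b u * K x a)"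
    for a b u
  have DP: "((\<lambda>y. P y a b) has_derivative P' a b) (at x)" for a b
    unfolding P_def[abs_def] P'_def[abs_def]
    by (rule has_derivative_diff[OF has_derivative_mult[OF DL DK] has_derivative_mult[OF DL DK]])
  have lam_mu: "wedge 1 1 \<kappa> \<mu> c y w = P y (w 0) (w 1)" if "y \<in> codom c" for y w
    unfolding P_def
    by (rule wedge_1_1_eq[of \<kappa> c y "L y" \<mu> "K y", OF lam[OF that] mu[OF that]])
  have P_anti: "P y a b = - P y b a" for y a b by (simp add: P_def)
  have omega: "wedge 2 2 (wedge 1 1 \<kappa> \<mu>) (ext_deriv 1 \<nu>) c y w =
      P y (w 0) (w 1) * N y (w 2) (w 3) - P y (w 0) (w 2) * N y (w 1) (w 3)
      + P y (w 0) (w 3) * N y (w 1) (w 2) + P y (w 1) (w 2) * N y (w 0) (w 3)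
      - P y (w 1) (w 3) * N y (w 0) (w 2) + P y (w 2) (w 3) * N y (w 0) (w 1)"
    if "y \<in> codom c" for y w
    by (rule wedge_2_2_eq[of "wedge 1 1 \<kappa> \<mu>" c y "P y" "ext_deriv 1 \<nu>" "N y",
          OF lam_mu[OF that] dnu[OF that] P_anti N_anti[OF that]])
  have D: "dir_deriv (\<lambda>y. wedge 2 2 (wedge 1 1 \<kappa> \<mu>) (ext_deriv 1 \<nu>) c y w) x u =
      (P x (w 0) (w 1) * N' (w 2) (w 3) u + P' (w 0) (w 1) u * N x (w 2) (w 3))
      - (P x (w 0) (w 2) * N' (w 1) (w 3) u + P' (w 0) (w 2) u * N x (w 1) (w 3))
      + (P x (w 0) (w 3) * N' (w 1) (w 2) u + P' (w 0) (w 3) u * N x (w 1) (w 2))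
      + (P x (w 1) (w 2) * N' (w 0) (w 3) u + P' (w 1) (w 2) u * N x (w 0) (w 3))
      - (P x (w 1) (w 3) * N' (w 0) (w 2) u + P' (w 1) (w 3) u * N x (w 0) (w 2))
      + (P x (w 2) (w 3) * N' (w 0) (w 1) u + P' (w 2) (w 3) u * N x (w 0) (w 1))"
    for w u
    by (rule dir_derivI, rule has_derivative_cong_open[OF open_codom[OF c(1)] c(2), THEN iffD2],
        erule omega, intro has_derivative_mult has_derivative_add has_derivative_diff DP DN)
  have dlam: "ext_deriv 1 \<kappa> c x w = L' (w 1) (w 0) - L' (w 0) (w 1)" for w
    unfolding defs by (rule ext_deriv_1_eq[OF \<kappa> c])
  have dmu: "ext_deriv 1 \<mu> c x w = K' (w 1) (w 0) - K' (w 0) (w 1)" for w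
    unfolding defs by (rule ext_deriv_1_eq[OF \<mu> c])
  \<comment> \<open>\<open>d d\<close> of the last factor, which occurs below as a coefficient\<close>
  have coc: "N' b d a - N' a d b + N' a b d = 0" for a b d
    unfolding defs by (rule ext_deriv_ext_deriv_1[OF \<nu> c])
  \<comment> \<open>\<open>Q L'\<close> and \<open>Q K'\<close> are \<open>d\<kappa> \<and> d\<nu>\<close> and \<open>d\<mu> \<and> d\<nu>\<close>, and \<open>Z\<close> is \<open>d d\<nu>\<close>; all three vanish\<close>
  define Q where "Q F a b d e = (F b a - F a b) * N x d e - (F d a - F a d) * N x b e
      + (F e a - F a e) * N x b d + (F d b - F b d) * N x a e
      - (F e b - F b e) * N x a d + (F e d - F d e) * N x a b" for F :: "'e \<Rightarrow> 'e \<Rightarrow> real" and a b d e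
  have QL: "Q L' a b d e = 0" for a b d e
    unfolding Q_def
    using 1[of "\<lambda>i. if i = 0 then a else if i = 1 then b else if i = 2 then d else e"]
      wedge_2_2_eq[of "ext_deriv 1 \<kappa>" c x "\<lambda>a b. L' b a - L' a b" "ext_deriv 1 \<nu>" "N x",
        OF dlam dnu[OF c(2)] _ N_anti[OF c(2)],
        of "\<lambda>i. if i = 0 then a else if i = 1 then b else if i = 2 then d else e"]
    by (simp del: One_nat_def)
  have QK: "Q K' a b d e = 0" for a b d e
    unfolding Q_def
    using 2[of "\<lambda>i. if i = 0 then a else if i = 1 then b else if i = 2 then d else e"]
      wedge_2_2_eq[of "ext_deriv 1 \<mu>" c x "\<lambda>a b. K' b a - K' a b" "ext_deriv 1 \<nu>" "N x",
        OF dmu dnu[OF c(2)] _ N_anti[OF c(2)],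
        of "\<lambda>i. if i = 0 then a else if i = 1 then b else if i = 2 then d else e"]
    by (simp del: One_nat_def)
  define Z where "Z a b d = N' b d a - N' a d b + N' a b d" for a b d
  have e: "Suc 0 = 1" "Suc 1 = 2" "Suc 2 = 3" "Suc 3 = 4" by simp_all
  define v0 v1 v2 v3 v4 where "v0 = v 0" and "v1 = v 1" and "v2 = v 2" and "v3 = v 3" and "v4 = v 4"
  have "ext_deriv 4 (wedge 2 2 (wedge 1 1 \<kappa> \<mu>) (ext_deriv 1 \<nu>)) c x v =
    (K x v0 * Q L' v1 v2 v3 v4 - K x v1 * Q L' v0 v2 v3 v4 + K x v2 * Q L' v0 v1 v3 v4
      - K x v3 * Q L' v0 v1 v2 v4 + K x v4 * Q L' v0 v1 v2 v3)
    - (L x v0 * Q K' v1 v2 v3 v4 - L x v1 * Q K' v0 v2 v3 v4 + L x v2 * Q K' v0 v1 v3 v4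
      - L x v3 * Q K' v0 v1 v2 v4 + L x v4 * Q K' v0 v1 v2 v3)
    + (P x v0 v1 * Z v2 v3 v4 - P x v0 v2 * Z v1 v3 v4 + P x v0 v3 * Z v1 v2 v4
      - P x v0 v4 * Z v1 v2 v3 + P x v1 v2 * Z v0 v3 v4 - P x v1 v3 * Z v0 v2 v4
      + P x v1 v4 * Z v0 v2 v3 + P x v2 v3 * Z v0 v1 v4 - P x v2 v4 * Z v0 v1 v3
      + P x v3 v4 * Z v0 v1 v2)"
    unfolding ext_deriv_def[of 4] sum_atMost_numerals D
    by (simp add: e flip: v0_def v1_def v2_def v3_def v4_def del: One_nat_def)
      (simp add: Q_def Z_def P_def P'_def algebra_simps)
  then show ?thesis by (simp add: QL QK Z_def coc)
qed

section \<open>Differentiating identities between forms in the parameter\<close>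

lemma family_wedge_1_1:
  "smooth_form_family A 1 \<omega> \<Longrightarrow> smooth_form_family A 1 \<eta> \<Longrightarrow>
   smooth_form_family A 2 (\<lambda>t. wedge 1 1 (\<omega> t) (\<eta> t))"
  using family_wedge[of 1 \<omega> 1 \<eta>] by (simp only: one_add_one)

lemma family_wedge_1_2:
  "smooth_form_family A 1 \<omega> \<Longrightarrow> smooth_form_family A 2 \<eta> \<Longrightarrow>
   smooth_form_family A 3 (\<lambda>t. wedge 1 2 (\<omega> t) (\<eta> t))"
  using family_wedge[of 1 \<omega> 2 \<eta>] by (simp del: One_nat_def)

lemma family_wedge_2_2:
  "smooth_form_family A 2 \<omega> \<Longrightarrow> smooth_form_family A 2 \<eta> \<Longrightarrow>
   smooth_form_family A 4 (\<lambda>t. wedge 2 2 (\<omega> t) (\<eta> t))"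
  using family_wedge[of 2 \<omega> 2 \<eta>] by simp

lemma ext_deriv_cong:
  assumes "c \<in> A" "x \<in> codom c" "\<And>y w. y \<in> codom c \<Longrightarrow> \<omega> c y w = \<eta> c y w"
  shows "ext_deriv k \<omega> c x v = ext_deriv k \<eta> c x v"
proof -
  have "dir_deriv (\<lambda>y. \<omega> c y w) x = dir_deriv (\<lambda>y. \<eta> c y w) x" for w
    by (rule frechet_derivative_cong_open[OF open_codom[OF assms(1)] assms(2,3)])
  then show ?thesis by (simp add: ext_deriv_def)
qed

lemma ext_deriv_lincomb:
  assumes "k_form A k \<omega>" "k_form A k \<eta>" "c \<in> A" "x \<in> codom c"
  shows "ext_deriv k (\<lambda>c x v. a * \<omega> c x v + b * \<eta> c x v) c x v =
    a * ext_deriv k \<omega> c x v + b * ext_deriv k \<eta> c x v"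
proof -
  have "dir_deriv (\<lambda>y. a * \<omega> c y w + b * \<eta> c y w) x u =
      a * dir_deriv (\<lambda>y. \<omega> c y w) x u + b * dir_deriv (\<lambda>y. \<eta> c y w) x u" for w u
    by (rule dir_derivI)
      (intro has_derivative_add has_derivative_mult_right k_form_has_derivative[OF assms(1,3,4)]
        k_form_has_derivative[OF assms(2,3,4)])
  then show ?thesis
    by (simp add: ext_deriv_def sum.distrib sum_distrib_left algebra_simps)
qed

lemma form_dot_add:
  assumes "smooth_form_family A k \<omega>" "smooth_form_family A k \<eta>" "c \<in> A" "x \<in> codom c"
  shows "form_dot (\<lambda>s. form_add (\<omega> s) (\<eta> s)) t c x v = form_dot \<omega> t c x v + form_dot \<eta> t c x v"
proof -
  have "form_dot (\<lambda>s. form_add (\<omega> s) (\<eta> s)) t c x v = deriv (\<lambda>s. \<omega> s c x v + \<eta> s c x v) t"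
    by (simp only: form_dot_def form_add_def)
  also have "\<dots> = form_dot \<omega> t c x v + form_dot \<eta> t c x v"
    by (rule DERIV_imp_deriv[OF DERIV_add[OF family_DERIV[OF assms(1,3,4)] family_DERIV[OF assms(2,3,4)]]])
  finally show ?thesis .
qed

lemma wedge_ext_deriv_commute:
  assumes "k_form A 1 \<mu>" "k_form A 1 \<nu>" "c \<in> A" "x \<in> codom c"
  shows "wedge 2 2 (ext_deriv 1 \<mu>) (ext_deriv 1 \<nu>) c x v =
    wedge 2 2 (ext_deriv 1 \<nu>) (ext_deriv 1 \<mu>) c x v"
proof -
  let ?D = "\<lambda>\<mu> a b. ext_deriv 1 \<mu> c x (pair a b)"
  note \<mu> = ext_deriv_1_pair[OF assms(1,3,4)] and \<nu> = ext_deriv_1_pair[OF assms(2,3,4)]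
  show ?thesis
    unfolding wedge_2_2_eq[of "ext_deriv 1 \<mu>" c x "?D \<mu>" "ext_deriv 1 \<nu>" "?D \<nu>",
          OF \<mu>(1) \<nu>(1) \<mu>(2) \<nu>(2)]
      wedge_2_2_eq[of "ext_deriv 1 \<nu>" c x "?D \<nu>" "ext_deriv 1 \<mu>" "?D \<mu>",
          OF \<nu>(1) \<mu>(1) \<nu>(2) \<mu>(2)]
    by (simp add: mult_ac)
qed

text \<open>
  Differentiate the identity \<open>d\<mu> \<and> d\<nu> = 0\<close> in the parameter, move the parameter derivative inside
  \<open>d\<close>, and use that 2-forms commute.
\<close>

lemma form_dot_wedge_ext_deriv_eq_0:
  assumes \<mu>: "smooth_form_family A 1 \<mu>" and \<nu>: "smooth_form_family A 1 \<nu>"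
    and c: "c \<in> A" "x \<in> codom c"
    and 0: "\<And>s. wedge 2 2 (ext_deriv 1 (\<mu> s)) (ext_deriv 1 (\<nu> s)) c x v = 0"
  shows "wedge 2 2 (ext_deriv 1 (form_dot \<mu> t)) (ext_deriv 1 (\<nu> t)) c x v +
    wedge 2 2 (ext_deriv 1 (form_dot \<nu> t)) (ext_deriv 1 (\<mu> t)) c x v = 0"
proof -
  have "0 = form_dot (\<lambda>s. wedge 2 2 (ext_deriv 1 (\<mu> s)) (ext_deriv 1 (\<nu> s))) t c x v"
    by (simp only: form_dot_def 0 deriv_const)
  also have "\<dots> = wedge 2 2 (form_dot (\<lambda>s. ext_deriv 1 (\<mu> s)) t) (ext_deriv 1 (\<nu> t)) c x v +
      wedge 2 2 (ext_deriv 1 (\<mu> t)) (form_dot (\<lambda>s. ext_deriv 1 (\<nu> s)) t) c x v"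
    by (rule form_dot_wedge[OF family_ext_deriv_1[OF \<mu>] family_ext_deriv_1[OF \<nu>] c])
  also have "wedge 2 2 (form_dot (\<lambda>s. ext_deriv 1 (\<mu> s)) t) (ext_deriv 1 (\<nu> t)) c x v =
      wedge 2 2 (ext_deriv 1 (form_dot \<mu> t)) (ext_deriv 1 (\<nu> t)) c x v"
    by (rule wedge_cong) (simp_all add: ext_deriv_form_dot[OF \<mu> c] del: One_nat_def)
  also have "wedge 2 2 (ext_deriv 1 (\<mu> t)) (form_dot (\<lambda>s. ext_deriv 1 (\<nu> s)) t) c x v =
      wedge 2 2 (ext_deriv 1 (\<mu> t)) (ext_deriv 1 (form_dot \<nu> t)) c x v"
    by (rule wedge_cong) (simp_all add: ext_deriv_form_dot[OF \<nu> c] del: One_nat_def)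
  also have "\<dots> = wedge 2 2 (ext_deriv 1 (form_dot \<nu> t)) (ext_deriv 1 (\<mu> t)) c x v"
    by (rule wedge_ext_deriv_commute[OF family_k_form[OF \<mu>] family_k_form[OF family_form_dot[OF \<nu>]] c])
  finally show ?thesis by simp
qed

section \<open>Frobenius pairs\<close>

text \<open>
  The conditions on a defining pair that do not mention the foliations. Closedness of the 4-form and
  the comparison of two forms \<open>\<beta>\<close> for the same \<open>\<alpha>\<close> are consequences of these conditions, and they
  are preserved by passing from \<open>(\<alpha>, \<beta>)\<close> to \<open>(f \<alpha>, \<beta> - d (ln f))\<close>.
\<close>

definition frobenius_pair ::
  "(real \<Rightarrow> ('a, 'e) form) \<Rightarrow> (real \<Rightarrow> ('a, 'e) form) \<Rightarrow> bool" where
  "frobenius_pair \<alpha> \<beta> \<longleftrightarrow>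
     smooth_form_family A 1 \<alpha> \<and> (\<forall>t. nowhere_vanishing A (\<alpha> t)) \<and>
     smooth_form_family A 1 \<beta> \<and>
     (\<forall>t. form_eq A (ext_deriv 1 (\<alpha> t)) (wedge 1 1 (\<alpha> t) (\<beta> t)))"

lemma frobenius_pairD:
  assumes "frobenius_pair \<alpha> \<beta>"
  shows "smooth_form_family A 1 \<alpha>" "smooth_form_family A 1 \<beta>"
  using assms by (auto simp: frobenius_pair_def)

lemma nowhere_vanishing_ex:
  assumes "nowhere_vanishing A \<alpha>" "k_form A 1 \<alpha>" "c \<in> A" "x \<in> codom c"
  obtains w where "\<alpha> c x (\<lambda>_. w) \<noteq> 0"
proof -
  obtain v where "\<alpha> c x v \<noteq> 0" using assms(1,3,4) unfolding nowhere_vanishing_def by blast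
  then show ?thesis using that[of "v 0"] one_form_eval[OF assms(2-4), of v] by simp
qed

lemma frobenius_pair_ext_deriv:
  assumes "frobenius_pair \<alpha> \<beta>" "c \<in> A" "x \<in> codom c"
  shows "ext_deriv 1 (\<alpha> t) c x v =
    \<alpha> t c x (\<lambda>_. v 0) * \<beta> t c x (\<lambda>_. v 1) - \<alpha> t c x (\<lambda>_. v 1) * \<beta> t c x (\<lambda>_. v 0)"
proof -
  note k = frobenius_pairD[OF assms(1), THEN family_k_form]
  have "ext_deriv 1 (\<alpha> t) c x v = wedge 1 1 (\<alpha> t) (\<beta> t) c x v"
    using assms unfolding frobenius_pair_def form_eq_def by blast
  also have "\<dots> = \<alpha> t c x (\<lambda>_. v 0) * \<beta> t c x (\<lambda>_. v 1) - \<alpha> t c x (\<lambda>_. v 1) * \<beta> t c x (\<lambda>_. v 0)"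
    by (rule wedge_1_1_eq[of "\<alpha> t" c x "\<lambda>u. \<alpha> t c x (\<lambda>_. u)" "\<beta> t" "\<lambda>u. \<beta> t c x (\<lambda>_. u)",
          OF one_form_eval[OF k(1) assms(2,3)] one_form_eval[OF k(2) assms(2,3)]])
  finally show ?thesis .
qed

text \<open>
  This is \<open>\<alpha> \<and> d\<beta> = 0\<close>: apply \<open>d\<close> to \<open>d\<alpha> = \<alpha> \<and> \<beta>\<close> to get \<open>0 = d\<alpha> \<and> \<beta> - \<alpha> \<and> d\<beta>\<close>, and
  \<open>d\<alpha> \<and> \<beta> = \<alpha> \<and> \<beta> \<and> \<beta> = 0\<close>.
\<close>

lemma alpha_wedge_ext_deriv_beta:
  assumes pair: "frobenius_pair \<alpha> \<beta>" and c: "c \<in> A" "x \<in> codom c"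
  shows "\<alpha> t c x (\<lambda>_. u) * ext_deriv 1 (\<beta> t) c x (pair v w)
    - \<alpha> t c x (\<lambda>_. v) * ext_deriv 1 (\<beta> t) c x (pair u w)
    + \<alpha> t c x (\<lambda>_. w) * ext_deriv 1 (\<beta> t) c x (pair u v) = 0"
proof -
  note k = frobenius_pairD[OF pair, THEN family_k_form]
  define a where "a y u = \<alpha> t c y (\<lambda>_. u)" for y u
  define b where "b y u = \<beta> t c y (\<lambda>_. u)" for y u
  define a' where "a' v u = dir_deriv (\<lambda>y. a y v) x u" for v u
  define b' where "b' v u = dir_deriv (\<lambda>y. b y v) x u" for v u
  have Da: "((\<lambda>y. a y v) has_derivative a' v) (at x)" for v
    using k_form_has_derivative[OF k(1) c] by (simp add: a_def a'_def[abs_def])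
  have Db: "((\<lambda>y. b y v) has_derivative b' v) (at x)" for v
    using k_form_has_derivative[OF k(2) c] by (simp add: b_def b'_def[abs_def])
  have da: "ext_deriv 1 (\<alpha> t) c y (pair u v) = a y u * b y v - a y v * b y u"
    if "y \<in> codom c" for y u v
    by (simp add: frobenius_pair_ext_deriv[OF pair c(1) that] a_def b_def del: One_nat_def)
  have dda: "dir_deriv (\<lambda>y. ext_deriv 1 (\<alpha> t) c y (pair v w)) x u =
      (a x v * b' w u + a' v u * b x w) - (a x w * b' v u + a' w u * b x v)" for u v w
    by (rule dir_derivI, rule has_derivative_cong_open[OF open_codom[OF c(1)] c(2), THEN iffD2],
        erule da, intro has_derivative_diff has_derivative_mult Da Db)
  have a'_skew: "a' v u = a' u v + a x u * b x v - a x v * b x u" for u v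
    using da[OF c(2), of u v] ext_deriv_1_eq[OF k(1) c, of _ "pair u v"]
    by (simp add: a_def a'_def del: One_nat_def)
  have db: "ext_deriv 1 (\<beta> t) c x (pair u v) = b' v u - b' u v" for u v
    by (simp add: ext_deriv_1_eq[OF k(2) c] b_def b'_def del: One_nat_def)
  show ?thesis
    using ext_deriv_ext_deriv_1[OF k(1)[of t] c, of v w u]
    unfolding dda db a_def[symmetric] a'_skew[of v u] a'_skew[of w u] a'_skew[of w v]
    by (simp add: algebra_simps)
qed

text \<open>
  At a point, \<open>\<alpha>\<close> divides \<open>d\<beta>\<close> because \<open>\<alpha> \<and> d\<beta> = 0\<close>: for a vector \<open>w\<close> with \<open>\<alpha> w \<noteq> 0\<close> the quotient is
  \<open>\<gamma> = d\<beta> (w, _) / \<alpha> w\<close>.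
\<close>

lemma frobenius_pair_local:
  assumes pair: "frobenius_pair \<alpha> \<beta>" and c: "c \<in> A" "x \<in> codom c"
  obtains \<gamma> where "\<And>v. ext_deriv 1 (\<beta> t) c x v =
    \<alpha> t c x (\<lambda>_. v 0) * \<gamma> (v 1) - \<alpha> t c x (\<lambda>_. v 1) * \<gamma> (v 0)"
proof -
  note k = frobenius_pairD[OF pair, THEN family_k_form]
  obtain w where w: "\<alpha> t c x (\<lambda>_. w) \<noteq> 0"
    using pair nowhere_vanishing_ex[OF _ k(1) c] unfolding frobenius_pair_def by blast
  have "ext_deriv 1 (\<beta> t) c x v =
    \<alpha> t c x (\<lambda>_. v 0) * (ext_deriv 1 (\<beta> t) c x (pair w (v 1)) / \<alpha> t c x (\<lambda>_. w)) -
    \<alpha> t c x (\<lambda>_. v 1) * (ext_deriv 1 (\<beta> t) c x (pair w (v 0)) / \<alpha> t c x (\<lambda>_. w))" for v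
    using alpha_wedge_ext_deriv_beta[OF pair c, of t w "v 0" "v 1"] w
    by (subst ext_deriv_1_pair(1)[OF k(2) c]) (simp add: field_simps)
  then show ?thesis by (rule that[of "\<lambda>u. ext_deriv 1 (\<beta> t) c x (pair w u) / \<alpha> t c x (\<lambda>_. w)"])
qed

text \<open>
  Both \<open>d\<alpha>\<close> and \<open>d\<beta>\<close> are divisible by \<open>\<alpha>\<close>, and \<open>\<alpha> \<and> \<alpha> = 0\<close>.
\<close>

lemma frobenius_pair_wedge_eq_0:
  assumes pair: "frobenius_pair \<alpha> \<beta>" and c: "c \<in> A" "x \<in> codom c"
  shows "wedge 2 2 (ext_deriv 1 (\<alpha> t)) (ext_deriv 1 (\<beta> t)) c x v = 0"
    and "wedge 2 2 (ext_deriv 1 (\<beta> t)) (ext_deriv 1 (\<beta> t)) c x v = 0"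
proof -
  let ?a = "\<lambda>u. \<alpha> t c x (\<lambda>_. u)" and ?b = "\<lambda>u. \<beta> t c x (\<lambda>_. u)"
  obtain \<gamma> where \<gamma>: "\<And>v. ext_deriv 1 (\<beta> t) c x v = ?a (v 0) * \<gamma> (v 1) - ?a (v 1) * \<gamma> (v 0)"
    using frobenius_pair_local[OF pair c, of t] by blast
  note \<alpha> = frobenius_pair_ext_deriv[OF pair c, of t]
  show "wedge 2 2 (ext_deriv 1 (\<alpha> t)) (ext_deriv 1 (\<beta> t)) c x v = 0"
    by (subst wedge_2_2_eq[of "ext_deriv 1 (\<alpha> t)" c x "\<lambda>u v. ?a u * ?b v - ?a v * ?b u"
          "ext_deriv 1 (\<beta> t)" "\<lambda>u v. ?a u * \<gamma> v - ?a v * \<gamma> u", OF \<alpha> \<gamma>])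
      (simp_all add: algebra_simps)
  show "wedge 2 2 (ext_deriv 1 (\<beta> t)) (ext_deriv 1 (\<beta> t)) c x v = 0"
    by (subst wedge_2_2_eq[of "ext_deriv 1 (\<beta> t)" c x "\<lambda>u v. ?a u * \<gamma> v - ?a v * \<gamma> u"
          "ext_deriv 1 (\<beta> t)" "\<lambda>u v. ?a u * \<gamma> v - ?a v * \<gamma> u", OF \<gamma> \<gamma>])
      (simp_all add: algebra_simps)
qed

lemma family_dot_beta_form:
  assumes "smooth_form_family A 1 \<beta>"
  shows "smooth_form_family A 4 (dot_beta_form \<beta>)"
  using family_wedge_2_2[OF family_wedge_1_1[OF family_form_dot[OF assms] assms]
      family_ext_deriv_1[OF assms]]
  by (simp only: dot_beta_form_def[abs_def])

lemma closed_dot_beta_form: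
  assumes pair: "frobenius_pair \<alpha> \<beta>"
  shows "closed_form A 4 (dot_beta_form \<beta> t)"
  unfolding closed_form_def form_eq_def zero_form_def
proof (intro conjI ballI allI)
  note \<beta> = frobenius_pairD(2)[OF pair]
  show "k_form A 4 (dot_beta_form \<beta> t)"
    by (rule family_k_form[OF family_dot_beta_form[OF \<beta>]])
  fix c x v assume c: "c \<in> A" "x \<in> codom c"
  have "wedge 2 2 (ext_deriv 1 (form_dot \<beta> t)) (ext_deriv 1 (\<beta> t)) c x w = 0" for w
    using form_dot_wedge_ext_deriv_eq_0[OF \<beta> \<beta> c frobenius_pair_wedge_eq_0(2)[OF pair c],
        where t=t and v=w] by simp
  then show "ext_deriv 4 (dot_beta_form \<beta> t) c x v = 0"
    unfolding dot_beta_form_def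
    by (intro ext_deriv_4_wedge family_k_form[OF \<beta>] family_k_form[OF family_form_dot[OF \<beta>]] c
        frobenius_pair_wedge_eq_0(2)[OF pair c])
qed

section \<open>Cohomology classes\<close>

lemma exact_form_lincomb:
  assumes "exact_form A (Suc k) \<omega>" "exact_form A (Suc k) \<eta>"
  shows "exact_form A (Suc k) (\<lambda>c x v. a * \<omega> c x v + b * \<eta> c x v)"
proof -
  obtain \<theta> \<theta>' where \<theta>: "k_form A k \<theta>" "form_eq A \<omega> (ext_deriv k \<theta>)"
    and \<theta>': "k_form A k \<theta>'" "form_eq A \<eta> (ext_deriv k \<theta>')"
    using assms by (auto simp: exact_form_def)
  then have "form_eq A (\<lambda>c x v. a * \<omega> c x v + b * \<eta> c x v)
      (ext_deriv k (\<lambda>c x v. a * \<theta> c x v + b * \<theta>' c x v))"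
    by (simp add: form_eq_def ext_deriv_lincomb)
  then show ?thesis
    using k_form_lincomb[OF \<theta>(1) \<theta>'(1)] by (auto simp: exact_form_def)
qed

lemma exact_form_diff_sym:
  assumes "exact_form A (Suc k) (form_diff \<omega> \<eta>)"
  shows "exact_form A (Suc k) (form_diff \<eta> \<omega>)"
  using exact_form_lincomb[OF assms assms, of "- 1" 0] by (simp add: form_diff_def)

lemma exact_form_diff_trans:
  assumes "exact_form A (Suc k) (form_diff \<omega> \<eta>)" "exact_form A (Suc k) (form_diff \<eta> \<zeta>)"
  shows "exact_form A (Suc k) (form_diff \<omega> \<zeta>)"
  using exact_form_lincomb[OF assms, of 1 1] by (simp add: form_diff_def)

lemma cohomology_class_eq:
  assumes "closed_form A (Suc k) \<omega>" "closed_form A (Suc k) \<eta>"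
    and "exact_form A (Suc k) (form_diff \<omega> \<eta>)"
  shows "cohomology_class A (Suc k) \<omega> = cohomology_class A (Suc k) \<eta>"
proof -
  have "exact_form A (Suc k) (form_diff \<omega> \<zeta>) \<longleftrightarrow> exact_form A (Suc k) (form_diff \<eta> \<zeta>)" for \<zeta>
    using assms(3) exact_form_diff_sym exact_form_diff_trans by blast
  then show ?thesis
    using assms(1,2) by (auto simp: cohomology_class_def cohomologous_def)
qed

section \<open>Changing the second form of a Frobenius pair\<close>

lemma form_dot_func_form:
  "form_dot (\<lambda>s. func_form (h s)) t = func_form (\<lambda>c x. deriv (\<lambda>s. h s c x) t)"
  by (simp add: form_dot_def func_form_def)

lemma family_func_dot:
  "smooth_form_family A 0 (\<lambda>t. func_form (h t)) \<Longrightarrow>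
   smooth_form_family A 0 (\<lambda>t. func_form (\<lambda>c x. deriv (\<lambda>s. h s c x) t))"
  using family_form_dot by (simp flip: form_dot_func_form)

lemma func_form_has_derivative:
  assumes "smooth_form_family A 0 (\<lambda>t. func_form (h t))" "c \<in> A" "x \<in> codom c"
  shows "(h t c has_derivative dir_deriv (h t c) x) (at x)"
  using k_form_has_derivative[OF family_k_form[OF assms(1)] assms(2,3)] by (simp add: func_form_def)

text \<open>
  Here \<open>d\<beta>' = d\<beta>\<close>, so the 4-forms differ by \<open>dh\<^sub>t \<and> \<beta>' \<and> d\<beta> + \<beta>\<^sub>t \<and> dh \<and> d\<beta>\<close>, that is, by
  \<open>dh\<^sub>t \<and> \<beta>' \<and> d\<beta> - dh \<and> \<beta>\<^sub>t \<and> d\<beta>\<close>. This is the differential of \<open>h\<^sub>t \<beta>' \<and> d\<beta> - h \<beta>\<^sub>t \<and> d\<beta>\<close>, since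
  \<open>d\<beta> \<and> d\<beta>\<close> and its parameter derivative vanish.
\<close>

lemma exact_form_diff_add_differential:
  assumes \<beta>: "smooth_form_family A 1 \<beta>"
    and h: "smooth_form_family A 0 (\<lambda>t. func_form (h t))"
    and dbeta: "\<And>s c x v. c \<in> A \<Longrightarrow> x \<in> codom c \<Longrightarrow>
      wedge 2 2 (ext_deriv 1 (\<beta> s)) (ext_deriv 1 (\<beta> s)) c x v = 0"
  shows "exact_form A 4 (form_diff
    (dot_beta_form (\<lambda>t. form_add (\<beta> t) (ext_deriv 0 (func_form (h t)))) t) (dot_beta_form \<beta> t))"
proof -
  define \<beta>' where "\<beta>' = (\<lambda>t. form_add (\<beta> t) (ext_deriv 0 (func_form (h t))))"
  define h' where "h' = (\<lambda>t c x. deriv (\<lambda>s. h s c x) t)"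
  note dh = family_ext_deriv_0[OF h]
  have \<beta>': "smooth_form_family A 1 \<beta>'"
    unfolding \<beta>'_def by (rule family_form_add[OF \<beta> dh])
  have h': "smooth_form_family A 0 (\<lambda>t. func_form (h' t))"
    unfolding h'_def by (rule family_func_dot[OF h])
  note dotb = family_form_dot[OF \<beta>]
  note db = family_ext_deriv_1[OF \<beta>]
  let ?\<theta>1 = "form_scale (h' t) (wedge 1 2 (\<beta>' t) (ext_deriv 1 (\<beta> t)))"
  let ?\<theta>2 = "form_scale (h t) (wedge 1 2 (form_dot \<beta> t) (ext_deriv 1 (\<beta> t)))"
  have \<theta>: "k_form A 3 ?\<theta>1" "k_form A 3 ?\<theta>2"
    using family_k_form[OF family_form_scale[OF h' family_wedge_1_2[OF \<beta>' db]]]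
      family_k_form[OF family_form_scale[OF h family_wedge_1_2[OF dotb db]]] .
  have "form_diff (dot_beta_form \<beta>' t) (dot_beta_form \<beta> t) c x v =
      ext_deriv 3 (\<lambda>c x v. 1 * ?\<theta>1 c x v + (- 1) * ?\<theta>2 c x v) c x v"
    if c: "c \<in> A" "x \<in> codom c" for c x v
  proof -
    let ?b = "\<lambda>u. form_dot \<beta> t c x (\<lambda>_. u)" and ?B = "\<lambda>u. \<beta> t c x (\<lambda>_. u)"
    let ?D = "\<lambda>a b. ext_deriv 1 (\<beta> t) c x (pair a b)"
    let ?\<eta> = "\<lambda>u. dir_deriv (h t c) x u" and ?\<eta>' = "\<lambda>u. dir_deriv (h' t c) x u"
    have b_eval: "form_dot \<beta> t c x w = ?b (w 0)" for w
      by (rule one_form_eval[OF family_k_form[OF dotb] c])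
    have B_eval: "\<beta> t c x w = ?B (w 0)" for w
      by (rule one_form_eval[OF family_k_form[OF \<beta>] c])
    have B'_eval: "\<beta>' t c x w = ?B (w 0) + ?\<eta> (w 0)" for w
      unfolding \<beta>'_def form_add_def ext_deriv_0_func_form by (simp flip: B_eval)
    have b'_eval: "form_dot \<beta>' t c x w = ?b (w 0) + ?\<eta>' (w 0)" for w
      unfolding \<beta>'_def form_dot_add[OF \<beta> dh c] ext_deriv_form_dot[OF h c, symmetric]
        form_dot_func_form ext_deriv_0_func_form
      by (simp add: h'_def flip: b_eval)
    have D: "ext_deriv 1 (\<beta> t) c x w = ?D (w 0) (w 1)" "?D a b = - ?D b a" for w a b
      by (rule ext_deriv_1_pair[OF family_k_form[OF \<beta>] c])+
    have D'_eq: "ext_deriv 1 (\<beta>' t) c x w = ext_deriv 1 (\<beta> t) c x w" for w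
      using ext_deriv_lincomb[OF family_k_form[OF \<beta>] family_k_form[OF dh] c, where a=1 and b=1 and v=w]
        ext_deriv_ext_deriv_0[OF h c, of t w]
      by (simp add: \<beta>'_def form_add_def)
    have dbb: "wedge 2 2 (ext_deriv 1 (form_dot \<beta> t)) (ext_deriv 1 (\<beta> t)) c x v = 0"
      using form_dot_wedge_ext_deriv_eq_0[OF \<beta> \<beta> c dbeta[OF c], where t=t and v=v] by simp
    have dBB: "wedge 2 2 (ext_deriv 1 (\<beta>' t)) (ext_deriv 1 (\<beta> t)) c x v = 0"
      using wedge_cong[of "ext_deriv 1 (\<beta>' t)" c x "ext_deriv 1 (\<beta> t)"] D'_eq dbeta[OF c] by metis
    have 1: "dot_beta_form \<beta>' t c x v =
        wedge 2 2 (wedge 1 1 (form_dot \<beta>' t) (\<beta>' t)) (ext_deriv 1 (\<beta> t)) c x v"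
      unfolding dot_beta_form_def by (rule wedge_cong) (simp_all only: D'_eq)
    have d\<theta>: "ext_deriv 3 (\<lambda>c x v. 1 * ?\<theta>1 c x v + (- 1) * ?\<theta>2 c x v) c x v =
        wedge 2 2 (wedge 1 1 (ext_deriv 0 (func_form (h' t))) (\<beta>' t)) (ext_deriv 1 (\<beta> t)) c x v -
        wedge 2 2 (wedge 1 1 (ext_deriv 0 (func_form (h t))) (form_dot \<beta> t)) (ext_deriv 1 (\<beta> t)) c x v"
      unfolding ext_deriv_lincomb[OF \<theta> c]
        ext_deriv_3_scaled_wedge[OF family_k_form[OF h'] family_k_form[OF \<beta>'] family_k_form[OF \<beta>] c]
        ext_deriv_3_scaled_wedge[OF family_k_form[OF h] family_k_form[OF dotb] family_k_form[OF \<beta>] c]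
        dbb dBB by simp
    show ?thesis
      unfolding form_diff_def d\<theta> 1 dot_beta_form_def[of \<beta>]
        wedge_1_1_2_eq[of "form_dot \<beta>' t" c x "\<lambda>u. ?b u + ?\<eta>' u" "\<beta>' t" "\<lambda>u. ?B u + ?\<eta> u"
          "ext_deriv 1 (\<beta> t)" ?D, OF b'_eval B'_eval D]
        wedge_1_1_2_eq[of "form_dot \<beta> t" c x ?b "\<beta> t" ?B "ext_deriv 1 (\<beta> t)" ?D, OF b_eval B_eval D]
        wedge_1_1_2_eq[of "ext_deriv 0 (func_form (h' t))" c x ?\<eta>' "\<beta>' t" "\<lambda>u. ?B u + ?\<eta> u"
          "ext_deriv 1 (\<beta> t)" ?D, OF ext_deriv_0_func_form B'_eval D]
        wedge_1_1_2_eq[of "ext_deriv 0 (func_form (h t))" c x ?\<eta> "form_dot \<beta> t" ?b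
          "ext_deriv 1 (\<beta> t)" ?D, OF ext_deriv_0_func_form b_eval D]
      by (simp add: algebra_simps del: One_nat_def)
  qed
  then show ?thesis
    using k_form_lincomb[OF \<theta>, of 1 "- 1"] unfolding exact_form_def form_eq_def \<beta>'_def[symmetric]
    by auto
qed

text \<open>
  The quotient \<open>g\<close> of proportional forms is the ratio of inner products
  \<open>\<langle>\<alpha>, \<gamma>\<rangle> / \<langle>\<alpha>, \<alpha>\<rangle>\<close> of the coefficient vectors in the chart. This makes smoothness evident, while
  independence of the chart follows because \<open>\<gamma> = g \<alpha>\<close> determines \<open>g\<close>.
\<close>

lemma proportional_one_forms:
  assumes \<alpha>: "smooth_form_family A 1 \<alpha>" and nv: "\<And>t. nowhere_vanishing A (\<alpha> t)"
    and \<gamma>: "smooth_form_family A 1 \<gamma>"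
    and proportional: "\<And>t c x u v. c \<in> A \<Longrightarrow> x \<in> codom c \<Longrightarrow>
      \<alpha> t c x (\<lambda>_. u) * \<gamma> t c x (\<lambda>_. v) = \<alpha> t c x (\<lambda>_. v) * \<gamma> t c x (\<lambda>_. u)"
  obtains g where "smooth_form_family A 0 (\<lambda>t. func_form (g t))"
    and "\<And>t c x v. c \<in> A \<Longrightarrow> x \<in> codom c \<Longrightarrow> \<gamma> t c x v = g t c x * \<alpha> t c x v"
proof -
  define n where "n t c x = (\<Sum>b\<in>Basis. \<alpha> t c x (\<lambda>_. b) * \<alpha> t c x (\<lambda>_. b))" for t c x
  define g where "g t c x = (\<Sum>b\<in>Basis. \<alpha> t c x (\<lambda>_. b) * \<gamma> t c x (\<lambda>_. b)) / n t c x" for t c x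
  have n: "n t c x \<noteq> 0" if c: "c \<in> A" "x \<in> codom c" for t c x
  proof
    assume "n t c x = 0"
    then have "\<alpha> t c x (\<lambda>_. b) = 0" if "b \<in> Basis" for b
      using that by (auto simp: n_def sum_nonneg_eq_0_iff)
    then have "\<alpha> t c x (\<lambda>_. u) = 0" for u
      using linear_expand_basis[OF one_form_linear[OF family_k_form[OF \<alpha>] c], of t u] by simp
    then show False
      using nowhere_vanishing_ex[OF nv family_k_form[OF \<alpha>] c, of t] by metis
  qed
  have g: "\<gamma> t c x v = g t c x * \<alpha> t c x v" if c: "c \<in> A" "x \<in> codom c" for t c x v
  proof -
    have "n t c x * \<gamma> t c x (\<lambda>_. v 0) =
        (\<Sum>b\<in>Basis. \<alpha> t c x (\<lambda>_. b) * (\<alpha> t c x (\<lambda>_. b) * \<gamma> t c x (\<lambda>_. v 0)))"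
      by (simp add: n_def sum_distrib_right mult.assoc)
    also have "\<dots> = (\<Sum>b\<in>Basis. \<alpha> t c x (\<lambda>_. b) * \<gamma> t c x (\<lambda>_. b)) * \<alpha> t c x (\<lambda>_. v 0)"
      unfolding proportional[OF c, of t _ "v 0"] sum_distrib_right by (simp add: mult_ac)
    finally show ?thesis
      using n[OF c, of t] one_form_eval[OF family_k_form[OF \<alpha>] c, of t v]
        one_form_eval[OF family_k_form[OF \<gamma>] c, of t v]
      by (simp add: g_def field_simps)
  qed
  have "smooth_form_family A 0 (\<lambda>t. func_form (g t))"
  proof (rule smooth_form_familyI)
    fix t c x
    show "alternating_multilinear 0 (func_form (g t) c x)"
      by (simp add: alternating_multilinear_def func_form_def)
  next
    fix c v assume c: "c \<in> A"
    show "smooth_on (UNIV \<times> codom c) (\<lambda>p. func_form (g (fst p)) c (snd p) v)"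
      unfolding func_form_def g_def
    proof (rule smooth_on_divide)
      show "smooth_on (UNIV \<times> codom c) (\<lambda>p. n (fst p) c (snd p))"
        unfolding n_def
        by (intro smooth_on_sum smooth_on_mult family_joint_smooth[OF \<alpha> c] open_cylinder[OF c])
    qed (use n[OF c] in \<open>auto intro!: smooth_on_sum smooth_on_mult family_joint_smooth[OF \<alpha> c]
        family_joint_smooth[OF \<gamma> c] open_cylinder[OF c]\<close>)
  next
    fix t c d x v assume cd: "c \<in> A" "d \<in> A" "x \<in> overlap c d"
    let ?y = "transition c d x"
    have x: "x \<in> codom c" by (rule subsetD[OF overlap_subset_codom cd(3)])
    obtain w where w: "\<alpha> t c x (\<lambda>_. w) \<noteq> 0"
      using nowhere_vanishing_ex[OF nv family_k_form[OF \<alpha>] cd(1) x] .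
    have "g t c x * \<alpha> t c x (\<lambda>_. w) = g t d ?y * \<alpha> t c x (\<lambda>_. w)"
      using g[OF cd(1) x, of t "\<lambda>_. w"]
        g[OF cd(2) transition_in_codom[OF cd(1,3)], of t "\<lambda>_. dir_deriv (transition c d) x w"]
        k_form_natural[OF family_k_form[OF \<alpha>] cd, of t "\<lambda>_. w"]
        k_form_natural[OF family_k_form[OF \<gamma>] cd, of t "\<lambda>_. w"] by auto
    then show "func_form (g t) c x v = func_form (g t) d ?y (\<lambda>i. dir_deriv (transition c d) x (v i))"
      using w by (simp add: func_form_def)
  qed
  then show ?thesis using g by (rule that)
qed

lemma ext_deriv_1_scale:
  assumes g: "smooth_form_family A 0 (\<lambda>t. func_form (g t))" and \<alpha>: "k_form A 1 \<alpha>"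
    and c: "c \<in> A" "x \<in> codom c" and eq: "\<And>y v. y \<in> codom c \<Longrightarrow> \<gamma> c y v = g t c y * \<alpha> c y v"
    and \<gamma>: "k_form A 1 \<gamma>"
  shows "ext_deriv 1 \<gamma> c x v = dir_deriv (g t c) x (v 0) * \<alpha> c x (\<lambda>_. v 1)
    - dir_deriv (g t c) x (v 1) * \<alpha> c x (\<lambda>_. v 0) + g t c x * ext_deriv 1 \<alpha> c x v"
proof -
  have "dir_deriv (\<lambda>y. \<gamma> c y (\<lambda>_. w)) x u =
      g t c x * dir_deriv (\<lambda>y. \<alpha> c y (\<lambda>_. w)) x u + dir_deriv (g t c) x u * \<alpha> c x (\<lambda>_. w)" for w u
    by (rule dir_derivI, rule has_derivative_cong_open[OF open_codom[OF c(1)] c(2), THEN iffD2],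
        erule eq, intro has_derivative_mult func_form_has_derivative[OF g c] k_form_has_derivative[OF \<alpha> c])
  then show ?thesis
    unfolding ext_deriv_1_eq[OF \<alpha> c] ext_deriv_1_eq[OF \<gamma> c] by (simp add: algebra_simps)
qed

text \<open>
  Subtracting the two integrability equations gives \<open>\<alpha> \<and> (\<beta>' - \<beta>) = 0\<close>, so \<open>\<beta>' = \<beta> + g \<alpha>\<close>. The primitive
  is \<open>- 1/2 g \<kappa> \<and> d\<alpha>\<close> with \<open>\<kappa> = \<beta>\<^sub>t + \<beta>'\<^sub>t\<close>. Its differential contains \<open>d\<kappa> \<and> d\<alpha>\<close>, which involves derivatives
  of \<open>\<beta>\<^sub>t\<close>; the differentiated identity \<open>d\<alpha> \<and> d\<beta> = 0\<close> trades them for \<open>d\<alpha>\<^sub>t = \<alpha>\<^sub>t \<and> \<beta> + \<alpha> \<and> \<beta>\<^sub>t\<close>. After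
  that, everything is a polynomial in \<open>\<alpha>\<close>, \<open>\<alpha>\<^sub>t\<close>, \<open>\<beta>\<close>, \<open>\<beta>\<^sub>t\<close>, \<open>dg\<close>, \<open>g\<close>, \<open>g\<^sub>t\<close> and a quotient \<open>\<rho>\<close> with
  \<open>d\<beta> = \<alpha> \<and> \<rho>\<close>, and the two sides agree as polynomials.
\<close>

lemma exact_form_diff_same_defining_form:
  assumes pair: "frobenius_pair \<alpha> \<beta>" and pair': "frobenius_pair \<alpha> \<beta>'"
  shows "exact_form A 4 (form_diff (dot_beta_form \<beta>' t) (dot_beta_form \<beta> t))"
proof -
  note \<alpha> = frobenius_pairD(1)[OF pair] and \<beta> = frobenius_pairD(2)[OF pair]
    and \<beta>' = frobenius_pairD(2)[OF pair']
  have "smooth_form_family A 0 (\<lambda>t. func_form (\<lambda>c x. - 1))"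
    by (rule smooth_form_familyI)
      (simp_all add: alternating_multilinear_def func_form_def smooth_on_const open_cylinder)
  note neg = family_form_scale[OF this \<beta>]
  define \<gamma> where "\<gamma> = (\<lambda>t. form_add (\<beta>' t) (form_scale (\<lambda>c x. - 1) (\<beta> t)))"
  have \<gamma>: "smooth_form_family A 1 \<gamma>"
    unfolding \<gamma>_def by (rule family_form_add[OF \<beta>' neg])
  have \<gamma>_eq: "\<gamma> t c x v = \<beta>' t c x v - \<beta> t c x v" for t c x v
    by (simp add: \<gamma>_def form_add_def form_scale_def)
  have "\<alpha> t c x (\<lambda>_. u) * \<gamma> t c x (\<lambda>_. v) = \<alpha> t c x (\<lambda>_. v) * \<gamma> t c x (\<lambda>_. u)"
    if "c \<in> A" "x \<in> codom c" for t c x u v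
    using frobenius_pair_ext_deriv[OF pair that, of t "pair u v"]
      frobenius_pair_ext_deriv[OF pair' that, of t "pair u v"]
    by (simp add: \<gamma>_eq algebra_simps del: One_nat_def)
  then obtain g where g: "smooth_form_family A 0 (\<lambda>t. func_form (g t))"
    and \<gamma>g: "\<And>t c x v. c \<in> A \<Longrightarrow> x \<in> codom c \<Longrightarrow> \<gamma> t c x v = g t c x * \<alpha> t c x v"
    using proportional_one_forms[OF \<alpha> _ \<gamma>] pair unfolding frobenius_pair_def by blast
  note dota = family_form_dot[OF \<alpha>] and dotb = family_form_dot[OF \<beta>] and dotb' = family_form_dot[OF \<beta>']
  define \<kappa> where "\<kappa> = form_add (form_dot \<beta> t) (form_dot \<beta>' t)"
  have \<kappa>_fam: "smooth_form_family A 1 (\<lambda>t. form_add (form_dot \<beta> t) (form_dot \<beta>' t))"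
    by (rule family_form_add[OF dotb dotb'])
  have \<kappa>: "k_form A 1 \<kappa>" unfolding \<kappa>_def by (rule family_k_form[OF \<kappa>_fam])
  let ?\<theta> = "form_scale (g t) (wedge 1 2 \<kappa> (ext_deriv 1 (\<alpha> t)))"
  have \<theta>: "k_form A 3 ?\<theta>"
    unfolding \<kappa>_def
    by (rule family_k_form[OF family_form_scale[OF g family_wedge_1_2[OF \<kappa>_fam family_ext_deriv_1[OF \<alpha>]]]])
  have "form_diff (dot_beta_form \<beta>' t) (dot_beta_form \<beta> t) c x v =
      ext_deriv 3 (\<lambda>c x v. (- 1 / 2) * ?\<theta> c x v + 0 * ?\<theta> c x v) c x v"
    if c: "c \<in> A" "x \<in> codom c" for c x v
  proof -
    let ?A = "\<lambda>u. \<alpha> t c x (\<lambda>_. u)" and ?a = "\<lambda>u. form_dot \<alpha> t c x (\<lambda>_. u)"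
    let ?B = "\<lambda>u. \<beta> t c x (\<lambda>_. u)" and ?b = "\<lambda>u. form_dot \<beta> t c x (\<lambda>_. u)"
    let ?dg = "\<lambda>u. dir_deriv (g t c) x u" and ?g = "g t c x" and ?g' = "deriv (\<lambda>s. g s c x) t"
    obtain \<rho> where \<rho>: "\<And>v. ext_deriv 1 (\<beta> t) c x v = ?A (v 0) * \<rho> (v 1) - ?A (v 1) * \<rho> (v 0)"
      using frobenius_pair_local[OF pair c, of t] by blast
    have A_eval: "\<alpha> t c x w = ?A (w 0)" for w by (rule one_form_eval[OF family_k_form[OF \<alpha>] c])
    have B_eval: "\<beta> t c x w = ?B (w 0)" for w by (rule one_form_eval[OF family_k_form[OF \<beta>] c])
    have a_eval: "form_dot \<alpha> t c x w = ?a (w 0)" for w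
      by (rule one_form_eval[OF family_k_form[OF dota] c])
    have b_eval: "form_dot \<beta> t c x w = ?b (w 0)" for w
      by (rule one_form_eval[OF family_k_form[OF dotb] c])
    have \<beta>'_eq: "\<beta>' s c y w = \<beta> s c y w + \<gamma> s c y w" for s y w by (simp add: \<gamma>_eq)
    have B'_eval: "\<beta>' t c x w = ?B (w 0) + ?g * ?A (w 0)" for w
      unfolding \<beta>'_eq \<gamma>g[OF c] by (simp flip: A_eval B_eval)
    have dg_t: "((\<lambda>s. g s c x) has_real_derivative ?g') (at t)"
      using family_DERIV[OF g c, of _ t] unfolding form_dot_func_form by (simp add: func_form_def)
    have b'_eval: "form_dot \<beta>' t c x w = ?b (w 0) + (?g' * ?A (w 0) + ?g * ?a (w 0))" for w
    proof -
      have "((\<lambda>s. \<beta> s c x w + g s c x * \<alpha> s c x w) has_real_derivative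
          form_dot \<beta> t c x w + (?g' * \<alpha> t c x w + form_dot \<alpha> t c x w * ?g)) (at t)"
        by (intro DERIV_add DERIV_mult dg_t family_DERIV[OF \<alpha> c] family_DERIV[OF \<beta> c])
      moreover have "\<beta>' s c x w = \<beta> s c x w + g s c x * \<alpha> s c x w" for s
        unfolding \<beta>'_eq \<gamma>g[OF c] ..
      ultimately have "form_dot \<beta>' t c x w =
          form_dot \<beta> t c x w + (?g' * \<alpha> t c x w + form_dot \<alpha> t c x w * ?g)"
        unfolding form_dot_def[of \<beta>'] by (simp only: DERIV_imp_deriv)
      then show ?thesis by (simp add: mult.commute flip: A_eval a_eval b_eval)
    qed
    let ?dA = "\<lambda>u v. ?A u * ?B v - ?A v * ?B u"
    have dA: "ext_deriv 1 (\<alpha> t) c x w = ?dA (w 0) (w 1)" for w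
      by (rule frobenius_pair_ext_deriv[OF pair c])
    let ?da = "\<lambda>u v. (?a u * ?B v - ?a v * ?B u) + (?A u * ?b v - ?A v * ?b u)"
    have da: "ext_deriv 1 (form_dot \<alpha> t) c x w = ?da (w 0) (w 1)" for w
    proof -
      have "ext_deriv 1 (form_dot \<alpha> t) c x w = form_dot (\<lambda>s. wedge 1 1 (\<alpha> s) (\<beta> s)) t c x w"
        unfolding ext_deriv_form_dot[OF \<alpha> c]
        by (rule form_dot_cong) (use pair c in \<open>simp add: frobenius_pair_def form_eq_def\<close>)
      then show ?thesis
        unfolding form_dot_wedge[OF \<alpha> \<beta> c]
          wedge_1_1_eq[of "form_dot \<alpha> t" c x ?a "\<beta> t" ?B, OF a_eval B_eval]
          wedge_1_1_eq[of "\<alpha> t" c x ?A "form_dot \<beta> t" ?b, OF A_eval b_eval] .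
    qed
    let ?D = "\<lambda>u v. ?A u * \<rho> v - ?A v * \<rho> u"
    let ?D' = "\<lambda>u v. ?D u v + (?dg u * ?A v - ?dg v * ?A u + ?g * ?dA u v)"
    have D': "ext_deriv 1 (\<beta>' t) c x w = ?D' (w 0) (w 1)" for w
    proof -
      have "ext_deriv 1 (\<beta>' t) c x w = ext_deriv 1 (\<beta> t) c x w + ext_deriv 1 (\<gamma> t) c x w"
        using ext_deriv_lincomb[OF family_k_form[OF \<beta>] family_k_form[OF \<gamma>] c, where a=1 and b=1 and v=w]
          ext_deriv_cong[OF c, of "\<beta>' t" "\<lambda>c x v. \<beta> t c x v + \<gamma> t c x v" 1 w]
        by (simp add: \<beta>'_eq)
      moreover have "ext_deriv 1 (\<gamma> t) c x w = ?dg (w 0) * ?A (w 1) - ?dg (w 1) * ?A (w 0)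
          + ?g * ext_deriv 1 (\<alpha> t) c x w"
        by (rule ext_deriv_1_scale[OF g family_k_form[OF \<alpha>] c _ family_k_form[OF \<gamma>]])
          (rule \<gamma>g[OF c(1)])
      ultimately show ?thesis unfolding \<rho> dA by simp
    qed
    have dbA: "wedge 2 2 (ext_deriv 1 (form_dot \<beta> t)) (ext_deriv 1 (\<alpha> t)) c x v =
        - wedge 2 2 (ext_deriv 1 (form_dot \<alpha> t)) (ext_deriv 1 (\<beta> t)) c x v"
      using form_dot_wedge_ext_deriv_eq_0[OF \<alpha> \<beta> c frobenius_pair_wedge_eq_0(1)[OF pair c],
          where t=t and v=v] by linarith
    have dbA': "wedge 2 2 (ext_deriv 1 (form_dot \<beta>' t)) (ext_deriv 1 (\<alpha> t)) c x v =
        - wedge 2 2 (ext_deriv 1 (form_dot \<alpha> t)) (ext_deriv 1 (\<beta>' t)) c x v"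
      using form_dot_wedge_ext_deriv_eq_0[OF \<alpha> \<beta>' c frobenius_pair_wedge_eq_0(1)[OF pair' c],
          where t=t and v=v] by linarith
    have \<kappa>_eval: "\<kappa> c x w = 2 * ?b (w 0) + (?g' * ?A (w 0) + ?g * ?a (w 0))" for w
      unfolding \<kappa>_def form_add_def b'_eval by (simp flip: b_eval)
    have "wedge 2 2 (ext_deriv 1 \<kappa>) (ext_deriv 1 (\<alpha> t)) c x v =
        wedge 2 2 (\<lambda>c x v. ext_deriv 1 (form_dot \<beta> t) c x v + ext_deriv 1 (form_dot \<beta>' t) c x v)
          (ext_deriv 1 (\<alpha> t)) c x v"
      using ext_deriv_lincomb[OF family_k_form[OF dotb] family_k_form[OF dotb'] c, where a=1 and b=1]
      by (intro wedge_cong) (simp_all add: \<kappa>_def form_add_def)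
    also have "\<dots> = wedge 2 2 (ext_deriv 1 (form_dot \<beta> t)) (ext_deriv 1 (\<alpha> t)) c x v +
        wedge 2 2 (ext_deriv 1 (form_dot \<beta>' t)) (ext_deriv 1 (\<alpha> t)) c x v"
      by (simp add: wedge_def ring_distribs sum.distrib add_divide_distrib)
    finally have d\<kappa>: "wedge 2 2 (ext_deriv 1 \<kappa>) (ext_deriv 1 (\<alpha> t)) c x v =
        - (wedge 2 2 (ext_deriv 1 (form_dot \<alpha> t)) (ext_deriv 1 (\<beta> t)) c x v +
          wedge 2 2 (ext_deriv 1 (form_dot \<alpha> t)) (ext_deriv 1 (\<beta>' t)) c x v)"
      unfolding dbA dbA' by (simp del: One_nat_def)
    have d\<theta>: "ext_deriv 3 (\<lambda>c x v. (- 1 / 2) * ?\<theta> c x v + 0 * ?\<theta> c x v) c x v =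
      (?g * (wedge 2 2 (ext_deriv 1 (form_dot \<alpha> t)) (ext_deriv 1 (\<beta> t)) c x v +
          wedge 2 2 (ext_deriv 1 (form_dot \<alpha> t)) (ext_deriv 1 (\<beta>' t)) c x v)
        - wedge 2 2 (wedge 1 1 (ext_deriv 0 (func_form (g t))) \<kappa>) (ext_deriv 1 (\<alpha> t)) c x v) / 2"
      unfolding ext_deriv_lincomb[OF \<theta> \<theta> c]
        ext_deriv_3_scaled_wedge[OF family_k_form[OF g] \<kappa> family_k_form[OF \<alpha>] c] d\<kappa>
      by (simp add: field_simps del: One_nat_def)
    have skew: "?dA u w = - ?dA w u" "?da u w = - ?da w u" "?D u w = - ?D w u" "?D' u w = - ?D' w u"
      for u w by (simp_all add: algebra_simps)
    have "2 * (dot_beta_form \<beta>' t c x v - dot_beta_form \<beta> t c x v) =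
      ?g * (wedge 2 2 (ext_deriv 1 (form_dot \<alpha> t)) (ext_deriv 1 (\<beta> t)) c x v +
          wedge 2 2 (ext_deriv 1 (form_dot \<alpha> t)) (ext_deriv 1 (\<beta>' t)) c x v)
        - wedge 2 2 (wedge 1 1 (ext_deriv 0 (func_form (g t))) \<kappa>) (ext_deriv 1 (\<alpha> t)) c x v"
      unfolding dot_beta_form_def
        wedge_1_1_2_eq[of "ext_deriv 0 (func_form (g t))" c x ?dg \<kappa>
          "\<lambda>u. 2 * ?b u + (?g' * ?A u + ?g * ?a u)" "ext_deriv 1 (\<alpha> t)" ?dA,
          OF ext_deriv_0_func_form \<kappa>_eval dA skew(1)]
        wedge_2_2_eq[of "ext_deriv 1 (form_dot \<alpha> t)" c x ?da "ext_deriv 1 (\<beta> t)" ?D,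
          OF da \<rho> skew(2,3)]
        wedge_2_2_eq[of "ext_deriv 1 (form_dot \<alpha> t)" c x ?da "ext_deriv 1 (\<beta>' t)" ?D',
          OF da D' skew(2,4)]
        wedge_1_1_2_eq[of "form_dot \<beta>' t" c x "\<lambda>u. ?b u + (?g' * ?A u + ?g * ?a u)" "\<beta>' t"
          "\<lambda>u. ?B u + ?g * ?A u" "ext_deriv 1 (\<beta>' t)" ?D', OF b'_eval B'_eval D' skew(4)]
        wedge_1_1_2_eq[of "form_dot \<beta> t" c x ?b "\<beta> t" ?B "ext_deriv 1 (\<beta> t)" ?D,
          OF b_eval B_eval \<rho> skew(3)]
      by (simp add: algebra_simps)
    then show ?thesis
      unfolding form_diff_def d\<theta> by simp
  qed
  then show ?thesis
    using k_form_lincomb[OF \<theta> \<theta>, of "- 1 / 2" 0] unfolding exact_form_def form_eq_def by auto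
qed

section \<open>Changing the defining form\<close>

text \<open>
  With \<open>h = - ln f\<close> one has \<open>d (f \<alpha>) = df \<and> \<alpha> + f \<alpha> \<and> \<beta> = f \<alpha> \<and> (\<beta> + dh)\<close>. So \<open>\<beta> + dh\<close> is an
  intermediate choice: it is reached from \<open>\<beta>\<close> by adding a differential, and it shares the form \<open>\<alpha>'\<close>
  with \<open>\<beta>'\<close>.
\<close>

lemma exact_form_diff_rescale:
  assumes pair: "frobenius_pair \<alpha> \<beta>" and pair': "frobenius_pair \<alpha>' \<beta>'"
    and f: "smooth_form_family A 0 (\<lambda>t. func_form (f t))"
    and f_pos: "\<And>t c x. c \<in> A \<Longrightarrow> x \<in> codom c \<Longrightarrow> f t c x > 0"
    and \<alpha>'_eq: "\<And>t c x v. c \<in> A \<Longrightarrow> x \<in> codom c \<Longrightarrow> \<alpha>' t c x v = f t c x * \<alpha> t c x v"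
  shows "exact_form A 4 (form_diff (dot_beta_form \<beta>' t) (dot_beta_form \<beta> t))"
proof -
  note \<alpha> = frobenius_pairD(1)[OF pair] and \<alpha>' = frobenius_pairD(1)[OF pair']
    and \<beta> = frobenius_pairD(2)[OF pair] and \<beta>' = frobenius_pairD(2)[OF pair']
  define h where "h t c x = - ln (f t c x)" for t c x
  have h: "smooth_form_family A 0 (\<lambda>t. func_form (h t))"
  proof (rule smooth_form_familyI)
    fix t c x
    show "alternating_multilinear 0 (func_form (h t) c x)"
      by (simp add: alternating_multilinear_def func_form_def)
  next
    fix c v assume c: "c \<in> A"
    have "smooth_on (UNIV \<times> codom c) (\<lambda>p. f (fst p) c (snd p))"
      using family_joint_smooth[OF f c] by (simp add: func_form_def)
    then have "smooth_on (UNIV \<times> codom c) (\<lambda>p. 0 - ln (f (fst p) c (snd p)))"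
      using f_pos[OF c]
      by (intro smooth_on_diff smooth_on_const smooth_on_ln open_cylinder[OF c]) auto
    then show "smooth_on (UNIV \<times> codom c) (\<lambda>p. func_form (h (fst p)) c (snd p) v)"
      by (simp add: func_form_def h_def)
  next
    fix t c d x v assume "c \<in> A" "d \<in> A" "x \<in> overlap c d"
    from k_form_natural[OF family_k_form[OF f] this]
    show "func_form (h t) c x v =
      func_form (h t) d (transition c d x) (\<lambda>i. dir_deriv (transition c d) x (v i))"
      by (simp add: func_form_def h_def)
  qed
  define \<beta>1 where "\<beta>1 = (\<lambda>t. form_add (\<beta> t) (ext_deriv 0 (func_form (h t))))"
  have \<beta>1: "smooth_form_family A 1 \<beta>1"
    unfolding \<beta>1_def by (rule family_form_add[OF \<beta> family_ext_deriv_0[OF h]])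
  have "ext_deriv 1 (\<alpha>' t) c x v = wedge 1 1 (\<alpha>' t) (\<beta>1 t) c x v"
    if c: "c \<in> A" "x \<in> codom c" for t c x v
  proof -
    let ?A = "\<lambda>u. \<alpha> t c x (\<lambda>_. u)" and ?B = "\<lambda>u. \<beta> t c x (\<lambda>_. u)"
    let ?df = "\<lambda>u. dir_deriv (f t c) x u"
    have dh: "dir_deriv (h t c) x u = - (?df u / f t c x)" for u
    proof (rule dir_derivI)
      have "((\<lambda>y. ln (f t c y)) has_derivative (\<lambda>u. ?df u * inverse (f t c x))) (at x)"
        using has_derivative_ln[OF f_pos[OF c] func_form_has_derivative[OF f c]]
        by (simp add: mult.commute)
      from has_derivative_minus[OF this]
      show "(h t c has_derivative (\<lambda>u. - (?df u / f t c x))) (at x)"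
        by (simp add: h_def[abs_def] divide_inverse)
    qed
    have "ext_deriv 1 (\<alpha>' t) c x v = ?df (v 0) * ?A (v 1) - ?df (v 1) * ?A (v 0)
        + f t c x * ext_deriv 1 (\<alpha> t) c x v"
      by (rule ext_deriv_1_scale[OF f family_k_form[OF \<alpha>] c _ family_k_form[OF \<alpha>']])
        (rule \<alpha>'_eq[OF c(1)])
    moreover have "wedge 1 1 (\<alpha>' t) (\<beta>1 t) c x v =
        f t c x * ?A (v 0) * (?B (v 1) - ?df (v 1) / f t c x) -
        f t c x * ?A (v 1) * (?B (v 0) - ?df (v 0) / f t c x)"
    proof (rule wedge_1_1_eq[of "\<alpha>' t" c x "\<lambda>u. f t c x * ?A u" "\<beta>1 t"
          "\<lambda>u. ?B u - ?df u / f t c x"])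
      fix w
      show "\<alpha>' t c x w = f t c x * ?A (w 0)"
        unfolding \<alpha>'_eq[OF c] using one_form_eval[OF family_k_form[OF \<alpha>] c, of t w] by simp
      show "\<beta>1 t c x w = ?B (w 0) - ?df (w 0) / f t c x"
        unfolding \<beta>1_def form_add_def ext_deriv_0_func_form dh
        using one_form_eval[OF family_k_form[OF \<beta>] c, of t w] by simp
    qed
    moreover have "f t c x * p * (q - r / f t c x) = f t c x * p * q - p * r" for p q r
      using f_pos[OF c, of t] by (simp add: field_simps)
    ultimately show ?thesis
      unfolding frobenius_pair_ext_deriv[OF pair c] by (simp add: algebra_simps del: One_nat_def)
  qed
  then have pair1: "frobenius_pair \<alpha>' \<beta>1"
    using pair' \<beta>1 by (simp add: frobenius_pair_def form_eq_def)
  have "exact_form A (Suc 3) (form_diff (dot_beta_form \<beta>' t) (dot_beta_form \<beta>1 t))"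
    using exact_form_diff_same_defining_form[OF pair1 pair'] by simp
  moreover have "exact_form A (Suc 3) (form_diff (dot_beta_form \<beta>1 t) (dot_beta_form \<beta> t))"
    using exact_form_diff_add_differential[OF \<beta> h frobenius_pair_wedge_eq_0(2)[OF pair]]
    by (simp add: \<beta>1_def)
  ultimately show ?thesis
    using exact_form_diff_trans by fastforce
qed

lemma defining_pair_frobenius_pair: "defining_pair A F \<alpha> \<beta> \<Longrightarrow> frobenius_pair \<alpha> \<beta>"
  by (simp add: defining_pair_def frobenius_pair_def positive_defining_form_def)

text \<open>
  The local normal covector that witnesses smooth dependence is nonzero, as otherwise every vector
  would be tangent to the leaf and \<open>\<alpha>\<close> would vanish; pairing it with itself shows that it is a positive
  transverse vector.
\<close>

lemma ex_positive_transverse: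
  assumes F: "smooth_foliation_family A F" and \<alpha>: "positive_defining_form A (F t) \<alpha>"
    and c: "c \<in> A" "x \<in> codom c"
  shows "\<exists>v. v \<in> positive_transverse (F t) c x"
proof -
  obtain W and n :: "real \<times> 'e \<Rightarrow> 'e" where "(t, x) \<in> W"
    and "\<forall>(t, x)\<in>W. leaf_tangent (F t) c x = {v. n (t, x) \<bullet> v = 0} \<and>
                    positive_transverse (F t) c x = {v. n (t, x) \<bullet> v > 0}"
    using F c unfolding smooth_foliation_family_def by blast
  then have n: "leaf_tangent (F t) c x = {v. n (t, x) \<bullet> v = 0}"
    "positive_transverse (F t) c x = {v. n (t, x) \<bullet> v > 0}" by blast+
  have k: "k_form A 1 \<alpha>" "nowhere_vanishing A \<alpha>"
    using \<alpha> by (simp_all add: positive_defining_form_def)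
  obtain w where "\<alpha> c x (\<lambda>_. w) \<noteq> 0" using nowhere_vanishing_ex[OF k(2,1) c] .
  then have "w \<notin> leaf_tangent (F t) c x"
    using \<alpha> c unfolding positive_defining_form_def by blast
  then have "n (t, x) \<noteq> 0" unfolding n by auto
  then have "n (t, x) \<in> positive_transverse (F t) c x" unfolding n by simp
  then show ?thesis ..
qed

text \<open>
  Both defining forms have the tangent hyperplane of the leaf as kernel, so they are proportional;
  their values on a positive transverse vector show that the factor is positive.
\<close>

lemma exact_form_diff_defining_pairs:
  assumes F: "smooth_foliation_family A F"
    and pair: "defining_pair A F \<alpha> \<beta>" and pair': "defining_pair A F \<alpha>' \<beta>'"
  shows "exact_form A 4 (form_diff (dot_beta_form \<beta>' t) (dot_beta_form \<beta> t))"
proof -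
  note fp = defining_pair_frobenius_pair[OF pair] and fp' = defining_pair_frobenius_pair[OF pair']
  note \<alpha> = frobenius_pairD(1)[OF fp] and \<alpha>' = frobenius_pairD(1)[OF fp']
  have def: "positive_defining_form A (F t) (\<alpha> t)" "positive_defining_form A (F t) (\<alpha>' t)" for t
    using pair pair' by (simp_all add: defining_pair_def)
  have nv: "nowhere_vanishing A (\<alpha> t)" for t
    using def(1) by (simp add: positive_defining_form_def)
  have "\<alpha> t c x (\<lambda>_. u) * \<alpha>' t c x (\<lambda>_. v) = \<alpha> t c x (\<lambda>_. v) * \<alpha>' t c x (\<lambda>_. u)"
    if c: "c \<in> A" "x \<in> codom c" for t c x u v
  proof -
    let ?A = "\<lambda>u. \<alpha> t c x (\<lambda>_. u)" and ?A' = "\<lambda>u. \<alpha>' t c x (\<lambda>_. u)"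
    note l = one_form_linear[OF family_k_form[OF \<alpha>] c, of t]
      and l' = one_form_linear[OF family_k_form[OF \<alpha>'] c, of t]
    have "{v. ?A v = 0} = {v. ?A' v = 0}"
      using def[of t] c unfolding positive_defining_form_def by blast
    then have ker: "?A v = 0 \<Longrightarrow> ?A' v = 0" for v by blast
    have "?A' (?A u *\<^sub>R v - ?A v *\<^sub>R u) = 0"
      by (rule ker) (simp add: linear_diff[OF l] linear_scale[OF l])
    then show ?thesis by (simp add: linear_diff[OF l'] linear_scale[OF l'])
  qed
  then obtain f where f: "smooth_form_family A 0 (\<lambda>t. func_form (f t))"
    and \<alpha>'f: "\<And>t c x v. c \<in> A \<Longrightarrow> x \<in> codom c \<Longrightarrow> \<alpha>' t c x v = f t c x * \<alpha> t c x v"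
    using proportional_one_forms[OF \<alpha> nv \<alpha>'] by blast
  have "f t c x > 0" if c: "c \<in> A" "x \<in> codom c" for t c x
  proof -
    obtain v where v: "v \<in> positive_transverse (F t) c x"
      using ex_positive_transverse[OF F def(1) c] by blast
    then have "\<alpha> t c x (\<lambda>_. v) > 0" "\<alpha>' t c x (\<lambda>_. v) > 0"
      using def[of t] c unfolding positive_defining_form_def by blast+
    then show ?thesis unfolding \<alpha>'f[OF c] by (simp add: zero_less_mult_iff)
  qed
  then show ?thesis
    by (rule exact_form_diff_rescale[OF fp fp' f _ \<alpha>'f])
qed

lemma closed_zero_form: "closed_form A k zero_form"
  unfolding closed_form_def k_form_def form_eq_def zero_form_def
  by (auto simp: alternating_multilinear_def linear_zero smooth_on_const ext_deriv_def)

end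

theorem theorem4:
  fixes M :: "'a topology"
    and A :: "('a, 'e::euclidean_space) chart set"
    and F :: "real \<Rightarrow> ('a, 'e) chart set"
  assumes "smooth_manifold M A"
    and "smooth_foliation_family A F"
  shows "(\<forall>\<alpha> \<beta> t. defining_pair A F \<alpha> \<beta> \<longrightarrow> closed_form A 4 (dot_beta_form \<beta> t)) \<and>
         (\<exists>I. \<forall>t. I t \<in> de_Rham_cohomology A 4 \<and>
            (\<forall>\<alpha> \<beta>. defining_pair A F \<alpha> \<beta> \<longrightarrow> cohomology_class A 4 (dot_beta_form \<beta> t) = I t)) \<and>
         (\<forall>\<alpha> \<beta> \<alpha>' \<beta>' t. defining_pair A F \<alpha> \<beta> \<and> defining_pair A F \<alpha>' \<beta>' \<longrightarrow>
            cohomology_class A 4 (dot_beta_form \<beta> t) =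
            cohomology_class A 4 (dot_beta_form \<beta>' t))"
proof -
  interpret smooth_atlas M A
    using assms(1) by unfold_locales (simp add: smooth_manifold_def)
  have closed: "closed_form A 4 (dot_beta_form \<beta> t)" if "defining_pair A F \<alpha> \<beta>" for \<alpha> \<beta> t
    by (rule closed_dot_beta_form[OF defining_pair_frobenius_pair[OF that]])
  have indep: "cohomology_class A 4 (dot_beta_form \<beta> t) = cohomology_class A 4 (dot_beta_form \<beta>' t)"
    if "defining_pair A F \<alpha> \<beta>" "defining_pair A F \<alpha>' \<beta>'" for \<alpha> \<beta> \<alpha>' \<beta>' t
    using cohomology_class_eq[of 3 "dot_beta_form \<beta> t" "dot_beta_form \<beta>' t"]
      closed[OF that(1)] closed[OF that(2)] exact_form_diff_defining_pairs[OF assms(2) that(2,1)]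
    by simp
  have class_in: "cohomology_class A 4 \<omega> \<in> de_Rham_cohomology A 4" if "closed_form A 4 \<omega>" for \<omega>
    using that unfolding cohomology_class_def de_Rham_cohomology_def by (intro quotientI) simp
  have "\<exists>I. \<forall>t. I t \<in> de_Rham_cohomology A 4 \<and>
      (\<forall>\<alpha> \<beta>. defining_pair A F \<alpha> \<beta> \<longrightarrow> cohomology_class A 4 (dot_beta_form \<beta> t) = I t)"
  proof (cases "\<exists>\<alpha> \<beta>. defining_pair A F \<alpha> \<beta>")
    case True
    then obtain \<alpha> \<beta> where "defining_pair A F \<alpha> \<beta>" by blast
    then show ?thesis
      using class_in closed indep
      by (intro exI[of _ "\<lambda>t. cohomology_class A 4 (dot_beta_form \<beta> t)"]) blast
  next
    \<comment> \<open>without a defining pair the value of the invariant is arbitrary\<close>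
    case False
    then show ?thesis
      using class_in[OF closed_zero_form]
      by (intro exI[of _ "\<lambda>t. cohomology_class A 4 zero_form"]) blast
  qed
  then show ?thesis using closed indep by blast
qed

end
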